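(* Let $f$ be a slice regular function on $\mathbb B\cup\{1\}$ such that $f(\mathbb B)\subseteq\mathbb B$ and $f(1)=1$. Then the following statements hold true: (i) The derivative of $f$ at $1$ is real and $$f'(1)\geq\frac{2|1-f(0)|^2}{1-|f(0)|^2+|f'(0)|}.$$ In particular, $$f'(1)\geq\frac{|1-f(0)|^2}{1-|f(0)|^2}.$$ Moreover, equality holds in the last inequality if and only if $$f(q)=(1-q\overline u)^{-\ast}\ast(q-u)(1-\overline u)(1-u)^{-1}$$ for some point $u\in\mathbb B$. (ii) If further $f^{(k)}(0)=0$ for all $k=0,1,\ldots,n-1$ for some $n\in\mathbb N$, then $$f'(1)\geq n+\frac{2\big|1-f^{(n)}(0)/n!\big|^2}{1-\big|f^{(n)}(0)/n!\big|^2+|f^{(n+1)}(0)|/(n+1)!}.$$ In particular, $$f'(1)\geq n+\frac{\big|1-f^{(n)}(0)/n!\big|^2}{1-\big|f^{(n)}(0)/n!\big|^2}.$$ Moreover, equality holds in the last inequality if and only if $$f(q)=q^n(1-q\overline u)^{-\ast}\ast(q-u)(1-\overline u)(1-u)^{-1}$$ for some point $u\in\mathbb B$.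
   Context: $\mathbb H$ is the algebra of quaternions, $\mathbb B=\{q\in\mathbb H:|q|<1\}$, $\mathbb S=\{q\in\mathbb H:q^2=-1\}$, and $\mathbb C_I=\mathbb R\oplus I\mathbb R$ for $I\in\mathbb S$. A function $f$ on a domain $\Omega\subseteq\mathbb H$ is slice regular if for every $I\in\mathbb S$ its restriction $f_I$ to $\Omega\cap\mathbb C_I$ has continuous partial derivatives and satisfies $\frac12\left(\frac{\partial}{\partial x}+I\frac{\partial}{\partial y}\right)f_I(x+yI)=0$. The slice derivative is $f'(x+yI)=\frac12\left(\frac{\partial}{\partial x}-I\frac{\partial}{\partial y}\right)f_I(x+yI)$, again slice regular, and $f^{(n)}$ is its $n$-th iterate. "Slice regular on $\mathbb B\cup\{1\}$" means: slice regular on some domain $\Omega\subseteq\mathbb H$ containing $\mathbb B\cup\{1\}$ and such that $\Omega\cap\mathbb C_I$ is a domain of $\mathbb C_I$ for every $I\in\mathbb S$. On $\mathbb B$, slice regular functions are sums of power series $\sum q^na_n$, $a_n\in\mathbb H$. For $f=\sum q^na_n$, $g=\sum q^nb_n$: $f\ast g(q)=\sum q^n\big(\sum_{k=0}^na_kb_{n-k}\big)$, $f^c(q)=\sum q^n\overline{a_n}$, $f^s=f\ast f^c$, and the regular reciprocal is $f^{-\ast}(q)=f^s(q)^{-1}f^c(q)$. The fractions in (ii) are understood when their denominators are nonzero (the excluded degenerate case being $|f^{(n)}(0)|=n!$, i.e. $f(q)=q^n$). *)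

theory Defs
  imports "HOL-Analysis.Analysis"
begin

section \<open>The quaternions as a normed division algebra\<close>

datatype quat = Quat (qRe: real) (qI: real) (qJ: real) (qK: real)

lemma quat_eq_iff:
  "p = q \<longleftrightarrow> qRe p = qRe q \<and> qI p = qI q \<and> qJ p = qJ q \<and> qK p = qK q"
  by (cases p; cases q) auto

instantiation quat :: ring_1
begin

definition "0 = Quat 0 0 0 0"
definition "1 = Quat 1 0 0 0"
definition "p + q = Quat (qRe p + qRe q) (qI p + qI q) (qJ p + qJ q) (qK p + qK q)"
definition "p - q = Quat (qRe p - qRe q) (qI p - qI q) (qJ p - qJ q) (qK p - qK q)"
definition "- p = Quat (- qRe p) (- qI p) (- qJ p) (- qK p)"
definition "p * q = Quat
  (qRe p * qRe q - qI p * qI q - qJ p * qJ q - qK p * qK q)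
  (qRe p * qI q + qI p * qRe q + qJ p * qK q - qK p * qJ q)
  (qRe p * qJ q - qI p * qK q + qJ p * qRe q + qK p * qI q)
  (qRe p * qK q + qI p * qJ q - qJ p * qI q + qK p * qRe q)"

instance
  by standard
    (simp_all add: quat_eq_iff zero_quat_def one_quat_def plus_quat_def minus_quat_def
      uminus_quat_def times_quat_def algebra_simps)

end

lemma quat_sel_simps [simp]:
  "qRe 0 = 0" "qI 0 = 0" "qJ 0 = 0" "qK 0 = 0"
  "qRe 1 = 1" "qI 1 = 0" "qJ 1 = 0" "qK 1 = 0"
  "qRe (p + q) = qRe p + qRe q" "qI (p + q) = qI p + qI q"
  "qJ (p + q) = qJ p + qJ q" "qK (p + q) = qK p + qK q"
  "qRe (p - q) = qRe p - qRe q" "qI (p - q) = qI p - qI q"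
  "qJ (p - q) = qJ p - qJ q" "qK (p - q) = qK p - qK q"
  "qRe (- p) = - qRe p" "qI (- p) = - qI p" "qJ (- p) = - qJ p" "qK (- p) = - qK p"
  "qRe (p * q) = qRe p * qRe q - qI p * qI q - qJ p * qJ q - qK p * qK q"
  "qI (p * q) = qRe p * qI q + qI p * qRe q + qJ p * qK q - qK p * qJ q"
  "qJ (p * q) = qRe p * qJ q - qI p * qK q + qJ p * qRe q + qK p * qI q"
  "qK (p * q) = qRe p * qK q + qI p * qJ q - qJ p * qI q + qK p * qRe q"
  by (simp_all add: zero_quat_def one_quat_def plus_quat_def minus_quat_def
      uminus_quat_def times_quat_def)

definition qcnj :: "quat \<Rightarrow> quat" where
  "qcnj q = Quat (qRe q) (- qI q) (- qJ q) (- qK q)"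

lemma qcnj_sel [simp]:
  "qRe (qcnj q) = qRe q" "qI (qcnj q) = - qI q" "qJ (qcnj q) = - qJ q" "qK (qcnj q) = - qK q"
  by (simp_all add: qcnj_def)

instantiation quat :: real_normed_div_algebra
begin

definition "r *\<^sub>R q = Quat (r * qRe q) (r * qI q) (r * qJ q) (r * qK q)"
definition "norm q = sqrt ((qRe q)\<^sup>2 + (qI q)\<^sup>2 + (qJ q)\<^sup>2 + (qK q)\<^sup>2)"
definition "inverse (q::quat) = inverse ((norm q)\<^sup>2) *\<^sub>R qcnj q"
definition "p div (q::quat) = p * inverse q"
definition "sgn (q::quat) = inverse (norm q) *\<^sub>R q"
definition "dist p (q::quat) = norm (p - q)"
definition "uniformity = (INF e\<in>{0<..}. principal {(p::quat, q). dist p q < e})"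
definition "open (U :: quat set) \<longleftrightarrow> (\<forall>x\<in>U. \<forall>\<^sub>F (x', y) in uniformity. x' = x \<longrightarrow> y \<in> U)"

lemma scaleR_quat_sel:
  "qRe (r *\<^sub>R q) = r * qRe q" "qI (r *\<^sub>R q) = r * qI q"
  "qJ (r *\<^sub>R q) = r * qJ q" "qK (r *\<^sub>R q) = r * qK q"
  by (simp_all add: scaleR_quat_def)

lemma norm_quat_sq:
  "(norm q)\<^sup>2 = (qRe q)\<^sup>2 + (qI q)\<^sup>2 + (qJ q)\<^sup>2 + (qK q)\<^sup>2" for q :: quat
  by (simp add: norm_quat_def)

lemma norm_quat_0: "norm q = 0 \<longleftrightarrow> q = 0" for q :: quat
proof -
  have "norm q = 0 \<longleftrightarrow> (qRe q)\<^sup>2 + (qI q)\<^sup>2 + (qJ q)\<^sup>2 + (qK q)\<^sup>2 = 0"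
    by (simp add: norm_quat_def)
  also have "\<dots> \<longleftrightarrow> qRe q = 0 \<and> qI q = 0 \<and> qJ q = 0 \<and> qK q = 0"
    by (simp add: add_nonneg_eq_0_iff)
  finally show ?thesis
    by (simp add: quat_eq_iff)
qed

instance
proof
  fix r s :: real and p q :: quat and U :: "quat set"
  have norm_tuple: "norm x = norm (qRe x, qI x, qJ x, qK x)" for x :: quat
    by (simp add: norm_quat_def norm_Pair add.assoc)
  show "r *\<^sub>R (p + q) = r *\<^sub>R p + r *\<^sub>R q" "(r + s) *\<^sub>R p = r *\<^sub>R p + s *\<^sub>R p"
    "r *\<^sub>R s *\<^sub>R p = (r * s) *\<^sub>R p" "1 *\<^sub>R p = p"
    "r *\<^sub>R p * q = r *\<^sub>R (p * q)" "p * r *\<^sub>R q = r *\<^sub>R (p * q)"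
    by (simp_all add: quat_eq_iff scaleR_quat_sel algebra_simps)
  have cnj: "qcnj p * p = (norm p)\<^sup>2 *\<^sub>R 1" "p * qcnj p = (norm p)\<^sup>2 *\<^sub>R 1"
    unfolding norm_quat_sq
    by (simp_all add: quat_eq_iff scaleR_quat_sel power2_eq_square)
  show "inverse p * p = 1" "p * inverse p = 1" if "p \<noteq> 0"
  proof -
    have "(norm p)\<^sup>2 \<noteq> 0"
      using that by (simp add: norm_quat_0)
    moreover have "inverse p * p = inverse ((norm p)\<^sup>2) *\<^sub>R (qcnj p * p)"
      "p * inverse p = inverse ((norm p)\<^sup>2) *\<^sub>R (p * qcnj p)"
      by (simp_all add: inverse_quat_def quat_eq_iff scaleR_quat_sel algebra_simps)
    ultimately show "inverse p * p = 1" "p * inverse p = 1"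
      unfolding cnj by (simp_all add: quat_eq_iff scaleR_quat_sel)
  qed
  show "p div q = p * inverse q"
    by (simp add: divide_quat_def)
  show "inverse (0::quat) = 0"
    by (simp add: inverse_quat_def quat_eq_iff scaleR_quat_sel)
  show "dist p q = norm (p - q)" "sgn p = inverse (norm p) *\<^sub>R p"
    by (simp_all add: dist_quat_def sgn_quat_def)
  show "uniformity = (INF e\<in>{0<..}. principal {(x::quat, y). dist x y < e})"
    by (rule uniformity_quat_def)
  show "open U \<longleftrightarrow> (\<forall>x\<in>U. \<forall>\<^sub>F (x', y) in uniformity. x' = x \<longrightarrow> y \<in> U)"
    by (rule open_quat_def)
  show "norm p = 0 \<longleftrightarrow> p = 0"
    by (rule norm_quat_0)
  show "norm (p + q) \<le> norm p + norm q"
    using norm_triangle_ineq[of "(qRe p, qI p, qJ p, qK p)" "(qRe q, qI q, qJ q, qK q)"]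
    by (simp add: norm_tuple)
  have "(norm (r *\<^sub>R p))\<^sup>2 = (\<bar>r\<bar> * norm p)\<^sup>2"
    by (simp add: power_mult_distrib norm_quat_sq scaleR_quat_sel algebra_simps)
  then show "norm (r *\<^sub>R p) = \<bar>r\<bar> * norm p"
    by (rule power2_eq_imp_eq) (simp_all add: norm_quat_def)
  have "(norm (p * q))\<^sup>2 = (norm p * norm q)\<^sup>2"
    unfolding power_mult_distrib norm_quat_sq quat_sel_simps by algebra
  then show "norm (p * q) = norm p * norm q"
    by (rule power2_eq_imp_eq) (simp_all add: norm_quat_def)
qed

end

section \<open>Slice regularity\<close>

abbreviation qball :: "quat set" where
  "qball \<equiv> ball 0 1"

definition imag_units :: "quat set" where
  "imag_units = {q. q\<^sup>2 = - 1}"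

definition slice_pt :: "quat \<Rightarrow> real \<Rightarrow> real \<Rightarrow> quat" where
  "slice_pt I x y = of_real x + of_real y * I"

definition slice_plane :: "quat \<Rightarrow> quat set" where
  "slice_plane I = {slice_pt I x y | x y. True}"

definition domain_in :: "quat set \<Rightarrow> quat set \<Rightarrow> bool" where
  "domain_in X U \<longleftrightarrow> openin (top_of_set X) U \<and> connected U \<and> U \<noteq> {}"

definition slice_domain :: "quat set \<Rightarrow> bool" where
  "slice_domain \<Omega> \<longleftrightarrow> domain_in UNIV \<Omega> \<and>
     (\<forall>I\<in>imag_units. domain_in (slice_plane I) (\<Omega> \<inter> slice_plane I))"

definition slice_dx :: "(quat \<Rightarrow> quat) \<Rightarrow> quat \<Rightarrow> real \<Rightarrow> real \<Rightarrow> quat" where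
  "slice_dx f I x y = vector_derivative (\<lambda>t. f (slice_pt I t y)) (at x)"

definition slice_dy :: "(quat \<Rightarrow> quat) \<Rightarrow> quat \<Rightarrow> real \<Rightarrow> real \<Rightarrow> quat" where
  "slice_dy f I x y = vector_derivative (\<lambda>t. f (slice_pt I x t)) (at y)"

definition slice_C1 :: "(quat \<Rightarrow> quat) \<Rightarrow> quat \<Rightarrow> quat set \<Rightarrow> bool" where
  "slice_C1 f I \<Omega> \<longleftrightarrow>
     (\<forall>x y. slice_pt I x y \<in> \<Omega> \<longrightarrow>
        (\<lambda>t. f (slice_pt I t y)) differentiable at x \<and>
        (\<lambda>t. f (slice_pt I x t)) differentiable at y) \<and>
     continuous_on {(x, y). slice_pt I x y \<in> \<Omega>} (\<lambda>(x, y). slice_dx f I x y) \<and>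
     continuous_on {(x, y). slice_pt I x y \<in> \<Omega>} (\<lambda>(x, y). slice_dy f I x y)"

definition slice_regular_on :: "(quat \<Rightarrow> quat) \<Rightarrow> quat set \<Rightarrow> bool" where
  "slice_regular_on f \<Omega> \<longleftrightarrow>
     (\<forall>I\<in>imag_units. slice_C1 f I \<Omega> \<and>
        (\<forall>x y. slice_pt I x y \<in> \<Omega> \<longrightarrow>
           (1/2) *\<^sub>R (slice_dx f I x y + I * slice_dy f I x y) = 0))"

definition slice_regular_near :: "(quat \<Rightarrow> quat) \<Rightarrow> quat set \<Rightarrow> bool" where
  "slice_regular_near f A \<longleftrightarrow> (\<exists>\<Omega>. A \<subseteq> \<Omega> \<and> slice_domain \<Omega> \<and> slice_regular_on f \<Omega>)"

text \<open>
  A quaternion \<open>q = x + y I\<close> has more than one such representation: \<open>(I, y)\<close> and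
  \<open>(- I, - y)\<close> for non-real \<open>q\<close>, and every \<open>I\<close> for real \<open>q\<close>. If \<open>f\<close> is slice regular
  near \<open>q\<close>, they all give the same value below (lemma \<open>slice_deriv_slice_pt\<close>).
\<close>

definition slice_deriv :: "(quat \<Rightarrow> quat) \<Rightarrow> quat \<Rightarrow> quat" where
  "slice_deriv f q = (THE d. \<forall>I\<in>imag_units. \<forall>x y. q = slice_pt I x y \<longrightarrow>
     d = (1/2) *\<^sub>R (slice_dx f I x y - I * slice_dy f I x y))"

lemma imag_units_iff:
  "I \<in> imag_units \<longleftrightarrow> qRe I = 0 \<and> (qI I)\<^sup>2 + (qJ I)\<^sup>2 + (qK I)\<^sup>2 = 1"
proof
  assume "I \<in> imag_units"
  then have sq: "I * I = - 1"
    by (simp add: imag_units_def power2_eq_square)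
  then have eqs: "qRe I * qRe I - qI I * qI I - qJ I * qJ I - qK I * qK I = - 1"
    "qRe I * qI I = 0" "qRe I * qJ I = 0" "qRe I * qK I = 0"
    by (auto simp: quat_eq_iff)
  have "qRe I = 0"
  proof (rule ccontr)
    assume "qRe I \<noteq> 0"
    with eqs have "qRe I * qRe I = - 1"
      by simp
    moreover have "0 \<le> qRe I * qRe I"
      by simp
    ultimately show False
      by linarith
  qed
  then show "qRe I = 0 \<and> (qI I)\<^sup>2 + (qJ I)\<^sup>2 + (qK I)\<^sup>2 = 1"
    using eqs(1) by (simp add: power2_eq_square)
next
  assume "qRe I = 0 \<and> (qI I)\<^sup>2 + (qJ I)\<^sup>2 + (qK I)\<^sup>2 = 1"
  then show "I \<in> imag_units"
    by (simp add: imag_units_def power2_eq_square quat_eq_iff algebra_simps)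
qed

lemma slice_pt_alt: "slice_pt I x y = x *\<^sub>R 1 + y *\<^sub>R I"
  by (simp add: slice_pt_def of_real_def)

lemma slice_pt_eqD:
  assumes "I \<in> imag_units" "J \<in> imag_units" "slice_pt I x y = slice_pt J x' y'"
  shows "x' = x \<and> (y = 0 \<and> y' = 0 \<or> J = I \<and> y' = y \<or> J = - I \<and> y' = - y)"
proof -
  have I: "qRe I = 0" "(qI I)\<^sup>2 + (qJ I)\<^sup>2 + (qK I)\<^sup>2 = 1"
    and J: "qRe J = 0" "(qI J)\<^sup>2 + (qJ J)\<^sup>2 + (qK J)\<^sup>2 = 1"
    using assms by (simp_all add: imag_units_iff)
  have x: "x' = x"
    and e: "y * qI I = y' * qI J" "y * qJ I = y' * qJ J" "y * qK I = y' * qK J"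
    using assms(3) I J by (simp_all add: slice_pt_alt quat_eq_iff scaleR_quat_sel)
  have "y\<^sup>2 = (y * qI I)\<^sup>2 + (y * qJ I)\<^sup>2 + (y * qK I)\<^sup>2"
    using I(2) by (simp add: power_mult_distrib flip: distrib_left)
  also have "\<dots> = y'\<^sup>2"
    using J(2) unfolding e by (simp add: power_mult_distrib flip: distrib_left)
  finally have "y' = y \<or> y' = - y"
    by (auto simp: power2_eq_iff)
  then show ?thesis
  proof
    assume y: "y' = y"
    then have "y = 0 \<or> J = I"
      using e I J by (auto simp: quat_eq_iff)
    then show ?thesis
      using x y by auto
  next
    assume y: "y' = - y"
    have "y = 0 \<or> J = - I"
    proof (cases "y = 0")
      case False
      have "y * qI I = y * - qI J" "y * qJ I = y * - qJ J" "y * qK I = y * - qK J"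
        using e y by simp_all
      then have "qI I = - qI J" "qJ I = - qJ J" "qK I = - qK J"
        using False by (simp_all only: mult_cancel_left) simp_all
      then show ?thesis
        using I J by (simp add: quat_eq_iff)
    qed simp
    then show ?thesis
      using x y by auto
  qed
qed

lemma slice_deriv_slice_pt:
  assumes f: "slice_regular_on f \<Omega>" and I: "I \<in> imag_units" and mem: "slice_pt I x y \<in> \<Omega>"
  shows "slice_deriv f (slice_pt I x y) =
    (1/2) *\<^sub>R (slice_dx f I x y - I * slice_dy f I x y)"
proof -
  have CR: "slice_dx f J x' y' - J * slice_dy f J x' y' = 2 *\<^sub>R slice_dx f J x' y'"
    if "J \<in> imag_units" "slice_pt J x' y' \<in> \<Omega>" for J x' y'
  proof -
    have "slice_dx f J x' y' + J * slice_dy f J x' y' = 0"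
      using f that unfolding slice_regular_on_def by force
    then have "J * slice_dy f J x' y' = - slice_dx f J x' y'"
      by (simp add: add_eq_0_iff)
    then show ?thesis
      by (simp add: scaleR_2)
  qed
  have "slice_dx f I x y = slice_dx f J x' y'"
    if J: "J \<in> imag_units" and eq: "slice_pt I x y = slice_pt J x' y'" for J x' y'
  proof -
    have "slice_pt I t y = slice_pt J t y'" for t
      using slice_pt_eqD[OF I J eq] by (auto simp: slice_pt_def)
    then show ?thesis
      using slice_pt_eqD[OF I J eq] by (simp add: slice_dx_def)
  qed
  then have *: "(1/2) *\<^sub>R (slice_dx f I x y - I * slice_dy f I x y) =
      (1/2) *\<^sub>R (slice_dx f J x' y' - J * slice_dy f J x' y')"
    if "J \<in> imag_units" "slice_pt I x y = slice_pt J x' y'" for J x' y'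
    using CR[OF I mem] CR[OF that(1), of x' y'] mem that by auto
  show ?thesis
    unfolding slice_deriv_def
    using I * by (intro the_equality) blast+
qed

section \<open>Regular product and regular reciprocal on the unit ball\<close>

text \<open>
  Coefficients stand to the right of the powers of \<open>q\<close>. They are unique, since the restriction of
  the series to the real axis already determines them.
\<close>

definition qcoeff :: "(quat \<Rightarrow> quat) \<Rightarrow> nat \<Rightarrow> quat" where
  "qcoeff f = (THE a. \<forall>q\<in>qball. (\<lambda>n. q ^ n * a n) sums f q)"

definition reg_prod :: "(quat \<Rightarrow> quat) \<Rightarrow> (quat \<Rightarrow> quat) \<Rightarrow> quat \<Rightarrow> quat" where
  "reg_prod f g q = (\<Sum>n. q ^ n * (\<Sum>k\<le>n. qcoeff f k * qcoeff g (n - k)))"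

definition reg_conj :: "(quat \<Rightarrow> quat) \<Rightarrow> quat \<Rightarrow> quat" where
  "reg_conj f q = (\<Sum>n. q ^ n * qcnj (qcoeff f n))"

definition reg_symm :: "(quat \<Rightarrow> quat) \<Rightarrow> quat \<Rightarrow> quat" where
  "reg_symm f = reg_prod f (reg_conj f)"

definition reg_recip :: "(quat \<Rightarrow> quat) \<Rightarrow> quat \<Rightarrow> quat" where
  "reg_recip f q = inverse (reg_symm f q) * reg_conj f q"

definition reg_moebius :: "quat \<Rightarrow> quat \<Rightarrow> quat" where
  "reg_moebius u =
     reg_prod (reg_recip (\<lambda>q. 1 - q * qcnj u)) (\<lambda>q. (q - u) * (1 - qcnj u) * inverse (1 - u))"

end

theory Submission
  imports Defs "HOL-Complex_Analysis.Complex_Analysis"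
begin

text \<open>
  Everything is reduced to classical facts about one bounded holomorphic function. For an imaginary
  unit \<open>I\<close> choose an imaginary unit \<open>J\<close> that anticommutes with \<open>I\<close>. Every quaternion is uniquely
  \<open>\<alpha> + \<beta> J\<close> with \<open>\<alpha>, \<beta> \<in> \<complex>\<^sub>I\<close>, and \<open>\<bar>\<alpha> + \<beta> J\<bar>\<^sup>2 = \<bar>\<alpha>\<bar>\<^sup>2 + \<bar>\<beta>\<bar>\<^sup>2\<close>. On the slice \<open>\<complex>\<^sub>I\<close> a slice
  regular function therefore splits as \<open>f = F + G J\<close> with \<open>F\<close> and \<open>G\<close> holomorphic and
  \<open>\<bar>F\<bar>\<^sup>2 + \<bar>G\<bar>\<^sup>2 < 1\<close> on the disc, so that \<open>F\<close> is a holomorphic self-map of the disc with \<open>F 1 = 1\<close>,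
  whose derivative at \<open>1\<close> is the \<open>\<complex>\<^sub>I\<close>-component of \<open>f'(1)\<close>.

  Reality: a holomorphic self-map of the disc that fixes the boundary point \<open>1\<close> and is
  differentiable there has a real derivative (\<open>boundary_derivative_real\<close>). A single slice says
  nothing about \<open>G\<close>, but \<open>f'(1)\<close> is the same quaternion for every \<open>I\<close>, and a quaternion all of
  whose slice components are real is itself real.

  Inequality: let \<open>a\<^sub>n\<close> be the power series coefficients of \<open>f\<close> and choose the slice that contains
  \<open>a\<^sub>n\<close>. Then \<open>F z = z\<^sup>n h z\<close>, where \<open>h\<close> is bounded by \<open>1\<close>, \<open>h 0 = a\<^sub>n\<close> and
  \<open>\<bar>h'(0)\<bar> \<le> \<bar>a\<^sub>n\<^sub>+\<^sub>1\<bar>\<close>, and \<open>h'(1) = f'(1) - n\<close>. The classical estimate \<open>boundary_schwarz\<close> for \<open>h\<close>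
  gives the first bound, and the Schwarz-Pick inequality \<open>\<bar>h'(0)\<bar> \<le> 1 - \<bar>h(0)\<bar>\<^sup>2\<close> then gives the
  second one.

  Equality: if the second bound is attained, then equality holds in Schwarz-Pick, so \<open>h\<close> is a
  Moebius transformation and \<open>F\<close> is unimodular on the circle. Since \<open>\<bar>G\<bar>\<^sup>2 \<le> 1 - \<bar>F\<bar>\<^sup>2\<close>, the maximum
  principle forces \<open>G = 0\<close> (\<open>slice_extremal\<close>). Hence \<open>f\<close> is known on one slice, in particular on the
  real axis, which determines its power series and so \<open>f\<close> itself. The regular Moebius
  transformation is identified in the same way, by its values on the real axis, where the regular
  product is the pointwise product. The same argument with \<open>h\<close> constant shows that \<open>\<bar>a\<^sub>n\<bar> = 1\<close> forces
  \<open>a\<^sub>n\<^sub>+\<^sub>1 = 0\<close>, so that the fractions are defined exactly when \<open>\<bar>a\<^sub>n\<bar> < 1\<close>.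
\<close>

text \<open>
  Multiplication is kept opaque to the simplifier, so that quaternions can be manipulated as ring
  elements; products are expanded in coordinates only on request.
\<close>

declare quat_sel_simps(21-24) [simp del]

lemmas quat_mult_sel = quat_sel_simps(21-24)

section \<open>Slices as copies of the complex plane\<close>

definition slice_emb :: "quat \<Rightarrow> complex \<Rightarrow> quat" where
  "slice_emb I z = slice_pt I (Re z) (Im z)"

text \<open>
  The orthogonal projection onto \<open>\<complex>\<^sub>I\<close>, read as a complex number: \<open>- qRe (p * I)\<close> is the inner product
  of \<open>p\<close> with \<open>I\<close>. In this form complex linearity with respect to left multiplication follows
  from \<open>I\<^sup>2 = - 1\<close> and the trace identity \<open>qRe (p * q) = qRe (q * p)\<close>.
\<close>

definition slice_proj :: "quat \<Rightarrow> quat \<Rightarrow> complex" where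
  "slice_proj I p = Complex (qRe p) (- qRe (p * I))"

lemma imag_units_sq: "I \<in> imag_units \<Longrightarrow> I * I = - 1"
  by (simp add: imag_units_def power2_eq_square)

lemma norm_imag_unit: "I \<in> imag_units \<Longrightarrow> norm I = 1"
  by (simp add: imag_units_iff norm_quat_def)

lemma qRe_mult_commute: "qRe (p * q) = qRe (q * p)"
  by (simp add: quat_mult_sel)

lemma qRe_scaleR [simp]: "qRe (r *\<^sub>R p) = r * qRe p"
  by (rule scaleR_quat_sel)

lemma slice_emb_alt: "slice_emb I z = Re z *\<^sub>R 1 + Im z *\<^sub>R I"
  by (simp add: slice_emb_def slice_pt_alt)

lemma slice_emb_of_real [simp]: "slice_emb I (of_real x) = of_real x"
  by (simp add: slice_emb_alt of_real_def)

lemma slice_emb_0 [simp]: "slice_emb I 0 = 0"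
  and slice_emb_1 [simp]: "slice_emb I 1 = 1"
  by (simp_all add: slice_emb_alt)

lemma slice_emb_diff: "slice_emb I (z - w) = slice_emb I z - slice_emb I w"
  by (simp add: slice_emb_alt algebra_simps)

lemma slice_emb_mult:
  "I \<in> imag_units \<Longrightarrow> slice_emb I (z * w) = slice_emb I z * slice_emb I w"
  by (simp add: slice_emb_alt algebra_simps imag_units_sq)

lemma slice_emb_power: "I \<in> imag_units \<Longrightarrow> slice_emb I (z ^ n) = slice_emb I z ^ n"
  by (induction n) (simp_all add: slice_emb_mult)

lemma qcnj_slice_emb: "I \<in> imag_units \<Longrightarrow> qcnj (slice_emb I z) = slice_emb I (cnj z)"
  by (simp add: slice_emb_alt quat_eq_iff scaleR_quat_sel imag_units_iff)

lemma norm_slice_emb: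
  assumes "I \<in> imag_units" shows "norm (slice_emb I z) = norm z"
proof -
  have "qRe I = 0" and unit: "(qI I)\<^sup>2 + (qJ I)\<^sup>2 + (qK I)\<^sup>2 = 1"
    using assms by (simp_all add: imag_units_iff)
  then have "(norm (slice_emb I z))\<^sup>2 = (Re z)\<^sup>2 + (Im z)\<^sup>2 * ((qI I)\<^sup>2 + (qJ I)\<^sup>2 + (qK I)\<^sup>2)"
    unfolding norm_quat_sq distrib_left
    by (simp add: slice_emb_alt scaleR_quat_sel power_mult_distrib)
  also note unit
  finally have "(norm (slice_emb I z))\<^sup>2 = (norm z)\<^sup>2"
    by (simp add: cmod_power2)
  then show ?thesis
    by (rule power2_eq_imp_eq) simp_all
qed

lemma slice_emb_inverse:
  assumes "I \<in> imag_units" shows "slice_emb I (inverse z) = inverse (slice_emb I z)"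
proof (cases "z = 0")
  case False
  then have "slice_emb I (inverse z) * slice_emb I z = 1"
    by (simp flip: slice_emb_mult[OF assms])
  then show ?thesis
    by (metis inverse_unique inverse_inverse_eq)
qed simp

lemma bounded_linear_slice_emb: "bounded_linear (slice_emb I)"
proof (rule bounded_linear_intro[where K = "1 + norm I"])
  fix z :: complex
  have "norm (slice_emb I z) \<le> \<bar>Re z\<bar> + \<bar>Im z\<bar> * norm I"
    unfolding slice_emb_alt by (rule order_trans[OF norm_triangle_ineq]) simp
  also have "\<dots> \<le> norm z * (1 + norm I)"
    using mult_right_mono[OF abs_Im_le_cmod[of z], of "norm I"] abs_Re_le_cmod[of z]
    by (simp add: algebra_simps)
  finally show "norm (slice_emb I z) \<le> norm z * (1 + norm I)" .
qed (simp_all add: slice_emb_alt algebra_simps)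

lemma slice_proj_0 [simp]: "slice_proj I 0 = 0"
  by (simp add: slice_proj_def complex_eq_iff)

lemma slice_proj_add: "slice_proj I (p + q) = slice_proj I p + slice_proj I q"
  unfolding slice_proj_def distrib_right by (simp add: complex_eq_iff)

lemma slice_proj_scaleR: "slice_proj I (r *\<^sub>R p) = r *\<^sub>R slice_proj I p"
  unfolding slice_proj_def mult_scaleR_left qRe_scaleR by (simp add: complex_eq_iff)

lemma slice_proj_unit_mult:
  assumes "I \<in> imag_units" shows "slice_proj I (I * p) = \<i> * slice_proj I p"
proof -
  have "qRe (I * p * I) = - qRe p"
    unfolding qRe_mult_commute[of "I * p"] mult.assoc[symmetric] imag_units_sq[OF assms] by simp
  then show ?thesis
    unfolding slice_proj_def qRe_mult_commute[of p I] by (simp add: complex_eq_iff)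
qed

lemma slice_proj_emb_mult:
  assumes "I \<in> imag_units" shows "slice_proj I (slice_emb I z * p) = z * slice_proj I p"
  unfolding slice_emb_alt distrib_right slice_proj_add mult_scaleR_left slice_proj_scaleR
    slice_proj_unit_mult[OF assms] mult_1_left
  by (simp add: complex_eq_iff)

lemma slice_proj_1: "I \<in> imag_units \<Longrightarrow> slice_proj I 1 = 1"
  by (simp add: slice_proj_def complex_eq_iff imag_units_iff)

lemma slice_proj_emb [simp]: "I \<in> imag_units \<Longrightarrow> slice_proj I (slice_emb I z) = z"
  using slice_proj_emb_mult[of I z 1] by (simp add: slice_proj_1)

text \<open>
  The map \<open>p \<mapsto> - I p I\<close> fixes \<open>\<complex>\<^sub>I\<close> and negates its orthogonal complement, so averaging it with the
  identity is the projection.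
\<close>

lemma slice_emb_proj:
  assumes "I \<in> imag_units"
  shows "2 *\<^sub>R slice_emb I (slice_proj I p) = p - I * p * I"
proof -
  have "qRe I = 0"
    using assms by (simp add: imag_units_iff)
  then have "p * I + I * p = (2 * qRe p) *\<^sub>R I + (2 * qRe (p * I)) *\<^sub>R 1"
    by (simp add: quat_eq_iff scaleR_quat_sel quat_mult_sel)
  then have pI: "p * I = (2 * qRe p) *\<^sub>R I + (2 * qRe (p * I)) *\<^sub>R 1 - I * p"
    by (simp only: eq_diff_eq)
  have "I * p * I = I * ((2 * qRe p) *\<^sub>R I + (2 * qRe (p * I)) *\<^sub>R 1 - I * p)"
    unfolding pI[symmetric] by (simp only: mult.assoc)
  also have "\<dots> = - ((2 * qRe p) *\<^sub>R 1) + (2 * qRe (p * I)) *\<^sub>R I + p"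
    unfolding right_diff_distrib distrib_left mult_scaleR_right mult.assoc[symmetric]
      imag_units_sq[OF assms] by simp
  finally show ?thesis
    by (simp add: slice_emb_alt slice_proj_def scaleR_diff_right)
qed

text \<open>
  The data of a splitting of the quaternions as \<open>\<complex>\<^sub>I \<oplus> \<complex>\<^sub>I J\<close>.
\<close>

definition slice_frame :: "quat \<Rightarrow> quat \<Rightarrow> bool" where
  "slice_frame I J \<longleftrightarrow> I \<in> imag_units \<and> J \<in> imag_units \<and> J * I = - (I * J)"

lemma slice_frame_exists:
  assumes "I \<in> imag_units" obtains J where "slice_frame I J"
proof (cases "qI I = 0 \<and> qJ I = 0")
  case True
  have "slice_frame I (Quat 0 1 0 0)"
    using assms True by (auto simp: slice_frame_def imag_units_iff quat_eq_iff quat_mult_sel)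
  then show ?thesis by (rule that)
next
  case False
  define r where "r = sqrt ((qI I)\<^sup>2 + (qJ I)\<^sup>2)"
  have r: "r \<noteq> 0" "(qI I)\<^sup>2 + (qJ I)\<^sup>2 = r\<^sup>2"
    using False by (auto simp: r_def add_nonneg_eq_0_iff)
  define J where "J = Quat 0 (qJ I / r) (- qI I / r) 0"
  have "J \<in> imag_units"
    using r(1) unfolding J_def imag_units_iff
    by (simp add: power_divide r(2) add.commute[of "(qJ I)\<^sup>2"] flip: add_divide_distrib)
  moreover have "J * I = - (I * J)"
    using assms unfolding J_def imag_units_iff by (simp add: quat_eq_iff quat_mult_sel)
  ultimately have "slice_frame I J"
    using assms by (simp add: slice_frame_def)
  then show ?thesis by (rule that)
qed

text \<open>
  Right multiplication by \<open>- J\<close> moves the part of \<open>p\<close> in \<open>\<complex>\<^sub>I J\<close> into \<open>\<complex>\<^sub>I\<close>, so both components of \<open>p\<close>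
  are slice projections, of \<open>p\<close> and of \<open>- p J\<close>.
\<close>

lemma slice_decomp:
  assumes "slice_frame I J"
  shows "p = slice_emb I (slice_proj I p) + slice_emb I (slice_proj I (- (p * J))) * J"
proof -
  have I: "I \<in> imag_units" and J: "J \<in> imag_units" and anti: "J * I = - (I * J)"
    using assms by (auto simp: slice_frame_def)
  have JIJ: "J * I * J = I"
    using anti imag_units_sq[OF J] by (simp add: mult.assoc)
  have "2 *\<^sub>R (slice_emb I (slice_proj I (- (p * J))) * J) = (- (p * J) + I * p * J * I) * J"
    unfolding mult_scaleR_left[symmetric] slice_emb_proj[OF I] by (simp add: mult.assoc)
  also have "\<dots> = - (p * (J * J)) + I * p * (J * I * J)"
    by (simp add: algebra_simps)
  also have "\<dots> = p + I * p * I"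
    using JIJ imag_units_sq[OF J] by simp
  finally have "2 *\<^sub>R p = 2 *\<^sub>R (slice_emb I (slice_proj I p) + slice_emb I (slice_proj I (- (p * J))) * J)"
    unfolding scaleR_add_right slice_emb_proj[OF I] by (simp add: scaleR_2)
  then show ?thesis
    by (rule scaleR_left_imp_eq[rotated]) simp
qed

text \<open>
  The two summands are orthogonal because \<open>\<complex>\<^sub>I J\<close> contains no element with a nonzero real part.
\<close>

lemma norm_slice_sum:
  assumes "slice_frame I J"
  shows "(norm (slice_emb I a + slice_emb I b * J))\<^sup>2 = (norm a)\<^sup>2 + (norm b)\<^sup>2"
proof -
  have I: "I \<in> imag_units" and J: "J \<in> imag_units" and anti: "J * I = - (I * J)"
    using assms by (auto simp: slice_frame_def)
  have orth: "qRe (slice_emb I z * J) = 0" for z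
  proof -
    have "qRe (I * J) = 0"
      using arg_cong[OF anti, of qRe] qRe_mult_commute[of I J] by simp
    moreover have "qRe J = 0"
      using J by (simp add: imag_units_iff)
    ultimately show ?thesis
      unfolding slice_emb_alt distrib_right mult_scaleR_left by simp
  qed
  define x where "x = slice_emb I a"
  define y where "y = slice_emb I b * J"
  have "(norm (x + y))\<^sup>2 = (norm x)\<^sup>2 + (norm y)\<^sup>2 + 2 * qRe (qcnj x * y)"
    unfolding norm_quat_sq quat_sel_simps qcnj_sel by algebra
  also have "qcnj x * y = slice_emb I (cnj a * b) * J"
    by (simp add: x_def y_def qcnj_slice_emb[OF I] slice_emb_mult[OF I] mult.assoc)
  finally have "(norm (x + y))\<^sup>2 = (norm x)\<^sup>2 + (norm y)\<^sup>2"
    by (simp add: orth)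
  then show ?thesis
    unfolding x_def y_def by (simp only: norm_mult norm_slice_emb[OF I] norm_imag_unit[OF J] mult_1_right)
qed

lemma norm_slice_parts:
  assumes "slice_frame I J"
  shows "(norm p)\<^sup>2 = (norm (slice_proj I p))\<^sup>2 + (norm (slice_proj I (- (p * J))))\<^sup>2"
proof -
  have "(norm p)\<^sup>2 = (norm (slice_emb I (slice_proj I p)
      + slice_emb I (slice_proj I (- (p * J))) * J))\<^sup>2"
    by (rule arg_cong[OF slice_decomp[OF assms, of p], of "\<lambda>x. (norm x)\<^sup>2"])
  then show ?thesis
    unfolding norm_slice_sum[OF assms] .
qed

lemma norm_slice_proj_le:
  assumes "I \<in> imag_units" shows "norm (slice_proj I p) \<le> norm p"
proof -
  obtain J where "slice_frame I J"
    using slice_frame_exists[OF assms] .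
  then have "(norm (slice_proj I p))\<^sup>2 \<le> (norm p)\<^sup>2"
    using norm_slice_parts[of I J p] by simp
  then show ?thesis
    by (rule power2_le_imp_le) simp
qed

lemma bounded_linear_slice_proj:
  assumes "I \<in> imag_units" shows "bounded_linear (slice_proj I)"
  using norm_slice_proj_le[OF assms]
  by (intro bounded_linear_intro[where K = 1]) (auto simp: slice_proj_add slice_proj_scaleR)

lemma quat_in_some_slice:
  obtains I z where "I \<in> imag_units" "q = slice_emb I z"
proof -
  define r where "r = sqrt ((qI q)\<^sup>2 + (qJ q)\<^sup>2 + (qK q)\<^sup>2)"
  have r2: "r\<^sup>2 = (qI q)\<^sup>2 + (qJ q)\<^sup>2 + (qK q)\<^sup>2"
    by (simp add: r_def)
  show ?thesis
  proof (cases "r = 0")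
    case True
    then have "qI q = 0 \<and> qJ q = 0 \<and> qK q = 0"
      using r2 by (simp add: add_nonneg_eq_0_iff)
    then have "Quat 0 1 0 0 \<in> imag_units" "q = slice_emb (Quat 0 1 0 0) (of_real (qRe q))"
      by (auto simp: imag_units_iff quat_eq_iff scaleR_quat_sel slice_emb_alt)
    then show ?thesis by (rule that)
  next
    case False
    define I where "I = Quat 0 (qI q / r) (qJ q / r) (qK q / r)"
    have "I \<in> imag_units"
      using False unfolding I_def imag_units_iff
      by (simp add: power_divide flip: add_divide_distrib r2)
    moreover have "q = slice_emb I (Complex (qRe q) r)"
      using False unfolding I_def by (simp add: quat_eq_iff scaleR_quat_sel slice_emb_alt)
    ultimately show ?thesis by (rule that)
  qed
qed

section \<open>Boundary behaviour of bounded holomorphic functions on the disc\<close>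

lemma holomorphic_const_if_norm_max:
  assumes "h holomorphic_on ball 0 1" "\<And>z. norm z < 1 \<Longrightarrow> norm (h z) \<le> 1"
    and "norm \<xi> < 1" "norm (h \<xi>) = 1" "norm z < 1"
  shows "h z = h \<xi>"
proof -
  have "h constant_on ball 0 1"
    using assms by (intro maximum_modulus_principle[of h _ "ball 0 1" \<xi>]) auto
  then show ?thesis
    using assms by (auto simp: constant_on_def)
qed

lemma max_modulus_circle:
  assumes "h holomorphic_on ball 0 1" "norm z < r" "r < 1"
    and "\<And>w. norm w = r \<Longrightarrow> norm (h w) \<le> B"
  shows "norm (h z) \<le> B"
proof -
  have r: "0 < r"
    using assms(2) by (rule le_less_trans[OF norm_ge_zero])
  show ?thesis
  proof (rule maximum_modulus_frontier[of h "ball 0 r"])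
    show "h holomorphic_on interior (ball 0 r)"
      using assms(1,3) by (auto intro: holomorphic_on_subset)
    show "continuous_on (closure (ball 0 r)) h"
      using r assms(1,3)
      by (auto intro!: holomorphic_on_imp_continuous_on elim!: holomorphic_on_subset)
  qed (use assms r in auto)
qed

text \<open>
  On the circle of radius \<open>r\<close> the function \<open>h\<close> is at most \<open>1 / r\<^sup>n\<close>; the maximum principle carries this
  bound inside, and \<open>r\<close> tends to \<open>1\<close>.
\<close>

lemma bounded_divide_power:
  assumes "h holomorphic_on ball 0 1"
    and "\<And>z. norm z < 1 \<Longrightarrow> norm (z ^ n * h z) \<le> 1" and "norm z < 1"
  shows "norm (h z) \<le> 1"
proof -
  have *: "norm (h z) \<le> 1 / r ^ n" if r: "norm z < r" "r < 1" for r
  proof (rule max_modulus_circle[OF assms(1) r])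
    have "0 < r"
      using r(1) by (rule le_less_trans[OF norm_ge_zero])
    then show "norm (h w) \<le> 1 / r ^ n" if "norm w = r" for w
      using assms(2)[of w] that r by (simp add: norm_mult norm_power field_simps)
  qed
  have "((\<lambda>r. 1 / r ^ n) \<longlongrightarrow> 1 / 1 ^ n) (at_left (1::real))"
    by (intro tendsto_intros) auto
  moreover have "\<forall>\<^sub>F r in at_left 1. norm (h z) \<le> 1 / r ^ n"
    using eventually_at_left_real[OF assms(3)] by eventually_elim (auto intro: *)
  ultimately show ?thesis
    using tendsto_lowerbound[of _ "1 / 1 ^ n" "at_left (1::real)" "norm (h z)"] by force
qed

text \<open>
  Near the circle \<open>\<bar>F\<bar>\<close> is close to \<open>1\<close>,
  uniformly, so \<open>\<bar>G\<bar>\<close> is small on circles of radius close to \<open>1\<close> and, by the maximum principle, inside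
  them.
\<close>

lemma complementary_component_vanishes:
  assumes G: "G holomorphic_on ball 0 1"
    and F: "continuous_on (cball 0 1) F" "\<And>z. norm z = 1 \<Longrightarrow> norm (F z) = 1"
    and FG: "\<And>z. norm z < 1 \<Longrightarrow> (norm (F z))\<^sup>2 + (norm (G z))\<^sup>2 \<le> 1"
    and z: "norm z < 1"
  shows "G z = (0::complex)"
proof -
  have "norm (G z) \<le> e" if e: "e > 0" for e
  proof -
    have "uniformly_continuous_on (cball 0 1) (\<lambda>z. (norm (F z))\<^sup>2)"
      by (intro compact_uniformly_continuous continuous_intros F(1)) auto
    then obtain d where d: "d > 0"
      "\<And>v w. v \<in> cball 0 1 \<Longrightarrow> w \<in> cball 0 1 \<Longrightarrow> dist w v < d
        \<Longrightarrow> dist ((norm (F w))\<^sup>2) ((norm (F v))\<^sup>2) < e\<^sup>2"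
      using e unfolding uniformly_continuous_on_def by (metis zero_less_power)
    \<comment> \<open>A radius beyond \<open>z\<close> and within the modulus of continuity of the circle.\<close>
    define r where "r = max ((norm z + 1) / 2) (1 - d / 2)"
    have r: "norm z < r" "r < 1" "1 - r < d"
      using z d(1) by (auto simp: r_def max_def field_simps)
    then have r0: "0 < r"
      using norm_ge_zero[of z] by linarith
    show ?thesis
    proof (rule max_modulus_circle[OF G r(1,2)])
      fix w :: complex assume w: "norm w = r"
      define v where "v = w / r"
      have v: "norm v = 1"
        using w r0 by (simp add: v_def norm_divide)
      have "w - v = of_real (r - 1) * v"
        using r0 by (simp add: v_def field_simps)
      then have "dist w v < d"
        using r v by (simp add: dist_norm norm_mult del: of_real_diff)
      then have "dist ((norm (F w))\<^sup>2) ((norm (F v))\<^sup>2) < e\<^sup>2"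
        using v w r by (intro d(2)) auto
      then have "(norm (G w))\<^sup>2 \<le> e\<^sup>2"
        using FG[of w] F(2)[OF v] w r by (simp add: dist_real_def)
      then show "norm (G w) \<le> e"
        using e by (intro power2_le_imp_le[of "norm (G w)"]) auto
    qed
  qed
  then show ?thesis
    using field_le_epsilon[of "norm (G z)" 0] by simp
qed

lemma moebius_identity:
  fixes a w :: complex
  shows "(norm (1 - cnj a * w))\<^sup>2 = (norm (w - a))\<^sup>2 + (1 - (norm a)\<^sup>2) * (1 - (norm w)\<^sup>2)"
  unfolding cmod_power2 by simp algebra

lemma one_minus_cnj_mult_nonzero:
  fixes a w :: complex
  assumes "norm a < 1" "norm w \<le> 1"
  shows "1 - cnj a * w \<noteq> 0"
proof
  assume "1 - cnj a * w = 0"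
  then have "norm a * norm w = 1"
    by (metis complex_mod_cnj eq_iff_diff_eq_0 norm_mult norm_one)
  moreover have "norm a * norm w \<le> norm a * 1"
    using assms by (intro mult_left_mono) auto
  ultimately show False
    using assms by simp
qed

text \<open>
  Normalisation at the origin: composing with the Moebius transformation that sends \<open>h 0\<close> to \<open>0\<close>
  makes the Schwarz lemma applicable.
\<close>

lemma moebius_vanishing_at_0:
  assumes h: "h holomorphic_on ball 0 1" "\<And>z. norm z < 1 \<Longrightarrow> norm (h z) < 1"
    and \<phi>_def: "\<phi> = (\<lambda>z. (h z - h 0) / (1 - cnj (h 0) * h z))"
  shows "\<phi> holomorphic_on ball 0 1" "\<phi> 0 = 0" "\<And>z. norm z < 1 \<Longrightarrow> norm (\<phi> z) < 1"
    and "deriv \<phi> 0 = deriv h 0 / of_real (1 - (norm (h 0))\<^sup>2)"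
proof -
  have h0: "norm (h 0) < 1"
    using h(2) by simp
  have nz: "1 - cnj (h 0) * h z \<noteq> 0" if "norm z < 1" for z
    using one_minus_cnj_mult_nonzero[OF h0] h(2)[OF that] by simp
  show "\<phi> holomorphic_on ball 0 1"
    unfolding \<phi>_def using nz h(1) by (auto intro!: holomorphic_intros)
  show "\<phi> 0 = 0"
    by (simp add: \<phi>_def)
  show "norm (\<phi> z) < 1" if z: "norm z < 1" for z
  proof -
    have "0 < (1 - (norm (h 0))\<^sup>2) * (1 - (norm (h z))\<^sup>2)"
      using h0 h(2)[OF z] by (intro mult_pos_pos) (simp_all add: power_less_one_iff abs_square_less_1)
    then have "(norm (h z - h 0))\<^sup>2 < (norm (1 - cnj (h 0) * h z))\<^sup>2"
      unfolding moebius_identity by simp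
    then have "norm (h z - h 0) < norm (1 - cnj (h 0) * h z)"
      by (rule power2_less_imp_less) simp
    then show ?thesis
      using nz[OF z] by (simp add: \<phi>_def norm_divide)
  qed
  have dh: "(h has_field_derivative deriv h 0) (at 0)"
    using h(1) by (rule holomorphic_derivI) auto
  have "(\<phi> has_field_derivative deriv h 0 / (1 - cnj (h 0) * h 0)) (at 0)"
    unfolding \<phi>_def
    by (rule derivative_eq_intros dh refl)+ (use nz[of 0] in simp_all)
  moreover have "1 - cnj (h 0) * h 0 = of_real (1 - (norm (h 0))\<^sup>2)"
    using complex_norm_square[of "h 0"] by (simp add: mult.commute)
  ultimately show "deriv \<phi> 0 = deriv h 0 / of_real (1 - (norm (h 0))\<^sup>2)"
    by (simp add: DERIV_imp_deriv)
qed

text \<open>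
  The Schwarz lemma bounds the pseudo-hyperbolic distance between \<open>h z\<close> and \<open>h 0\<close> by \<open>\<bar>z\<bar>\<close>. With
  \<open>s = \<bar>h z\<bar>\<close>, \<open>B = \<bar>h 0\<bar>\<close> and \<open>r = \<bar>z\<bar>\<close> this bound implies \<open>s - B \<le> r (1 - B s)\<close>, because
  \<open>(1 - B s)\<^sup>2 - (1 - B\<^sup>2) (1 - s\<^sup>2) = (s - B)\<^sup>2\<close>.
\<close>

lemma disc_growth:
  assumes h: "h holomorphic_on ball 0 1" "\<And>z. norm z < 1 \<Longrightarrow> norm (h z) \<le> 1" and z: "norm z < 1"
  shows "norm (h z) \<le> (norm z + norm (h 0)) / (1 + norm (h 0) * norm z)"
proof (cases "norm (h 0) = 1")
  case True
  then show ?thesis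
    using h(2)[OF z] by (simp add: add.commute add_pos_nonneg[of 1, THEN less_imp_neq, symmetric])
next
  case False
  have lt: "norm (h w) < 1" if "norm w < 1" for w
  proof (rule ccontr)
    assume "\<not> norm (h w) < 1"
    then have "norm (h w) = 1"
      using h(2)[OF that] by simp
    then have "h 0 = h w"
      by (intro holomorphic_const_if_norm_max h that) auto
    then show False
      using False \<open>norm (h w) = 1\<close> by simp
  qed
  define \<phi> where "\<phi> = (\<lambda>z. (h z - h 0) / (1 - cnj (h 0) * h z))"
  note \<phi> = moebius_vanishing_at_0[OF h(1) lt \<phi>_def]
  define r B s where rBs: "r = norm z" "B = norm (h 0)" "s = norm (h z)"
  have bounds: "0 \<le> r" "r < 1" "0 \<le> B" "B < 1" "0 \<le> s" "s < 1"
    using lt[of 0] lt[of z] z by (auto simp: rBs)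
  have "norm (\<phi> z) \<le> r"
    unfolding rBs using \<phi>(1-3) z by (intro Schwarz_Lemma(1)) auto
  moreover have "1 - cnj (h 0) * h z \<noteq> 0"
    using one_minus_cnj_mult_nonzero[of "h 0" "h z"] lt[of 0] lt[OF z] by simp
  ultimately have "norm (h z - h 0) \<le> r * norm (1 - cnj (h 0) * h z)"
    by (simp add: \<phi>_def norm_divide field_simps)
  then have "(norm (h z - h 0))\<^sup>2 \<le> r\<^sup>2 * (norm (1 - cnj (h 0) * h z))\<^sup>2"
    by (metis power_mono norm_ge_zero power_mult_distrib)
  then have "(1 - r\<^sup>2) * (norm (1 - cnj (h 0) * h z))\<^sup>2 \<le> (1 - B\<^sup>2) * (1 - s\<^sup>2)"
    using moebius_identity[of "h 0" "h z"] by (simp add: rBs algebra_simps)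
  moreover have "(1 - B * s)\<^sup>2 \<le> (norm (1 - cnj (h 0) * h z))\<^sup>2"
  proof (rule power_mono)
    show "1 - B * s \<le> norm (1 - cnj (h 0) * h z)"
      using norm_triangle_ineq2[of 1 "cnj (h 0) * h z"] by (simp add: rBs norm_mult)
    show "0 \<le> 1 - B * s"
      using bounds mult_le_one[of B s] by simp
  qed
  then have "(1 - r\<^sup>2) * (1 - B * s)\<^sup>2 \<le> (1 - r\<^sup>2) * (norm (1 - cnj (h 0) * h z))\<^sup>2"
    using bounds by (intro mult_left_mono) (auto simp: abs_square_le_1)
  ultimately have "(s - B)\<^sup>2 \<le> (r * (1 - B * s))\<^sup>2"
    by (simp add: power2_eq_square algebra_simps)
  then have "s - B \<le> r * (1 - B * s)"
    by (rule power2_le_imp_le) (use bounds mult_le_one[of B s] in auto)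
  moreover have "0 < 1 + B * r"
    using bounds by (simp add: add_pos_nonneg)
  ultimately show ?thesis
    unfolding rBs[symmetric] by (simp add: field_simps)
qed

lemma derivative_nonpos_at_left_min:
  fixes L :: "real \<Rightarrow> real"
  assumes "(L has_real_derivative l) (at b)" "a < b" "\<And>x. a < x \<Longrightarrow> x < b \<Longrightarrow> L b \<le> L x"
  shows "l \<le> 0"
proof (rule ccontr)
  assume "\<not> l \<le> 0"
  then obtain d where d: "d > 0" "\<And>h. h > 0 \<Longrightarrow> h < d \<Longrightarrow> L (b - h) < L b"
    using DERIV_pos_inc_left[OF assms(1)] by auto
  define h where "h = min (d / 2) ((b - a) / 2)"
  have "h > 0" "h < d" "a < b - h"
    using d(1) assms(2) by (auto simp: h_def min_def field_simps)
  then show False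
    using d(2)[of h] assms(3)[of "b - h"] by force
qed

lemma has_real_derivative_along_line:
  assumes "(F has_field_derivative d) (at (c + of_real t * v))"
  shows "((\<lambda>x. Re (F (c + of_real x * v))) has_real_derivative Re (v * d)) (at t)"
    and "((\<lambda>x. Im (F (c + of_real x * v))) has_real_derivative Im (v * d)) (at t)"
proof -
  have "((\<lambda>x. F (c + of_real x * v)) has_vector_derivative v * d) (at t)"
  proof (rule field_vector_diff_chain_at[of "\<lambda>x. c + of_real x * v" v t F d, unfolded o_def])
    show "((\<lambda>x. c + of_real x * v) has_vector_derivative v) (at t)"
      by (auto intro!: derivative_eq_intros)
  qed (use assms in simp)
  then show "((\<lambda>x. Re (F (c + of_real x * v))) has_real_derivative Re (v * d)) (at t)"
    "((\<lambda>x. Im (F (c + of_real x * v))) has_real_derivative Im (v * d)) (at t)"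
    unfolding has_real_derivative_iff_has_vector_derivative
    by (rule bounded_linear.has_vector_derivative[OF bounded_linear_Re]
        bounded_linear.has_vector_derivative[OF bounded_linear_Im])+
qed

text \<open>
  For every direction \<open>v\<close> pointing into the disc, \<open>Re F\<close> attains along \<open>1 + t v\<close> its maximum \<open>1\<close> at
  \<open>t = 0\<close>, so \<open>Re (v d) \<le> 0\<close>. The directions \<open>- 1 + \<i> s\<close>, for all real \<open>s\<close>, leave no room for an
  imaginary part of \<open>d\<close>.
\<close>

lemma boundary_derivative_real:
  assumes F: "(F has_field_derivative d) (at 1)" "F 1 = 1" "\<And>z. norm z < 1 \<Longrightarrow> norm (F z) \<le> 1"
  shows "Im d = 0"
proof -
  have "0 \<le> Re d + s * Im d" for s
  proof -
    define v where "v = Complex (-1) s"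
    have "((\<lambda>x. Re (F (1 + of_real x * (- v)))) has_real_derivative Re (- v * d)) (at 0)"
      using has_real_derivative_along_line(1)[of F d 1 0 "- v"] F(1) by simp
    then have "((\<lambda>x. - Re (F (1 + of_real x * (- v)))) has_real_derivative - Re (- v * d)) (at 0)"
      by (rule DERIV_minus)
    moreover have "- (2 / (1 + s\<^sup>2)) < 0"
      by (simp add: add_pos_nonneg)
    ultimately have "- Re (- v * d) \<le> 0"
    proof (rule derivative_nonpos_at_left_min)
      fix x :: real assume x: "- (2 / (1 + s\<^sup>2)) < x" "x < 0"
      have "0 < 1 + s\<^sup>2"
        by (simp add: add_pos_nonneg)
      with x(1) have "0 < 2 + x * (1 + s\<^sup>2)"
        by (simp add: field_simps)
      then have "x * (2 + x * (1 + s\<^sup>2)) < 0"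
        using x(2) by (simp add: mult_neg_pos)
      then have "(norm (1 + of_real x * (- v)))\<^sup>2 < 1"
        unfolding cmod_power2 by (simp add: v_def power2_eq_square algebra_simps)
      then have "norm (1 + of_real x * (- v)) < 1"
        by (simp add: abs_square_less_1)
      from F(3)[OF this] have "Re (F (1 + of_real x * (- v))) \<le> 1"
        using complex_Re_le_cmod order_trans by blast
      then show "- Re (F (1 + of_real 0 * (- v))) \<le> - Re (F (1 + of_real x * (- v)))"
        using F(2) by simp
    qed
    then show ?thesis
      by (simp add: v_def)
  qed
  from this[of "- (\<bar>Re d\<bar> + 1) / Im d"] show ?thesis
    by (cases "Im d = 0") (auto simp: abs_if split: if_splits)
qed

text \<open>
  Writing the normalised function as \<open>\<phi> z = z \<psi> z\<close> and applying \<open>disc_growth\<close> to \<open>\<psi>\<close> gives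
  \<open>\<bar>\<phi> x\<bar> \<le> g x = x (x + B) / (1 + B x)\<close> on the radius towards \<open>1\<close>, where \<open>B = \<bar>\<psi> 0\<bar> = \<bar>\<phi>'(0)\<bar>\<close>. After
  clearing the denominator of \<open>\<phi>\<close>, both sides agree at \<open>x = 1\<close>; comparing their derivatives there, with
  \<open>g'(1) = 2 / (1 + B)\<close>, is the claim.
\<close>

lemma boundary_schwarz:
  assumes h: "h holomorphic_on ball 0 1" "\<And>z. norm z < 1 \<Longrightarrow> norm (h z) < 1"
    and d: "(h has_field_derivative d) (at 1)" "h 1 = 1"
  shows "Re d \<ge> 2 * (norm (1 - h 0))\<^sup>2 / (1 - (norm (h 0))\<^sup>2 + norm (deriv h 0))"
    and "norm (deriv h 0) \<le> 1 - (norm (h 0))\<^sup>2"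
proof -
  define a A where "a = h 0" and "A = 1 - (norm a)\<^sup>2"
  have a: "norm a < 1"
    using h(2) by (simp add: a_def)
  then have A: "A > 0"
    by (simp add: A_def abs_square_less_1)
  define \<phi> where "\<phi> = (\<lambda>z. (h z - h 0) / (1 - cnj (h 0) * h z))"
  note \<phi> = moebius_vanishing_at_0[OF h \<phi>_def]
  have deriv_\<phi>: "deriv \<phi> 0 = deriv h 0 / of_real (1 - (norm (h 0))\<^sup>2)"
    by (rule \<phi>(4))
  have d\<phi>: "norm (deriv \<phi> 0) = norm (deriv h 0) / A"
    using A unfolding deriv_\<phi> norm_divide norm_of_real A_def a_def by simp
  have "norm (deriv \<phi> 0) \<le> 1"
    using \<phi>(1-3) by (intro Schwarz_Lemma(2)[of \<phi> 0]) auto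
  then show *: "norm (deriv h 0) \<le> 1 - (norm (h 0))\<^sup>2"
    using A unfolding d\<phi> a_def[symmetric] A_def[symmetric] by (simp add: field_simps)
  obtain \<psi> where \<psi>: "\<psi> holomorphic_on ball 0 1" "\<And>z. norm z < 1 \<Longrightarrow> \<phi> z = z * \<psi> z" "deriv \<phi> 0 = \<psi> 0"
    using Schwarz3[OF \<phi>(1,2)] by metis
  have \<psi>_le: "norm (\<psi> z) \<le> 1" if "norm z < 1" for z
    using bounded_divide_power[OF \<psi>(1), of 1 z] \<psi>(2) \<phi>(3) that by fastforce
  define B where "B = norm (\<psi> 0)"
  have B: "B \<ge> 0" "B = norm (deriv h 0) / A"
    unfolding B_def d\<phi>[symmetric] \<psi>(3) by simp_all
  define g where "g = (\<lambda>x. x * (x + B) / (1 + B * x))"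
  \<comment> \<open>\<open>N\<close> is \<open>\<bar>1 - cnj a h x\<bar>\<^sup>2\<close>, written with the real and imaginary parts of \<open>h\<close> so that it can be differentiated.\<close>
  define R M where "R = (\<lambda>x::real. Re (h (of_real x)))" and "M = (\<lambda>x::real. Im (h (of_real x)))"
  define N where "N = (\<lambda>x. (1 - (Re a * R x + Im a * M x))\<^sup>2 + (Re a * M x - Im a * R x)\<^sup>2)"
  have N: "N x = (norm (1 - cnj a * h (of_real x)))\<^sup>2" for x
    by (simp add: N_def R_def M_def cmod_power2 power2_commute)
  \<comment> \<open>The difference of the two sides of \<open>\<bar>\<phi> x\<bar>\<^sup>2 \<le> (g x)\<^sup>2\<close> after multiplication by \<open>N\<close>.\<close>
  define L where "L = (\<lambda>x. A * (1 - (R x)\<^sup>2 - (M x)\<^sup>2) - (1 - (g x)\<^sup>2) * N x)"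
  have L: "L x = A * (1 - (norm (h (of_real x)))\<^sup>2) - (1 - (g x)\<^sup>2) * N x" for x
    by (simp add: L_def R_def M_def cmod_power2 algebra_simps)
  have L_nonneg: "0 \<le> L x" if x: "0 < x" "x < 1" for x
  proof -
    let ?z = "complex_of_real x"
    have z: "norm ?z < 1"
      using x by simp
    have "norm (\<phi> ?z) = x * norm (\<psi> ?z)"
      using \<psi>(2)[OF z] x by (simp add: norm_mult)
    also have "\<dots> \<le> x * ((x + B) / (1 + B * x))"
      using disc_growth[OF \<psi>(1) \<psi>_le z] x by (intro mult_left_mono) (auto simp: B_def)
    finally have "norm (\<phi> ?z) \<le> g x"
      by (simp add: g_def)
    then have "(norm (\<phi> ?z))\<^sup>2 \<le> (g x)\<^sup>2"
      by (intro power_mono) auto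
    then have "(norm (\<phi> ?z))\<^sup>2 * N x \<le> (g x)\<^sup>2 * N x"
      by (intro mult_right_mono) (auto simp: N)
    moreover have "1 - cnj a * h ?z \<noteq> 0"
      using one_minus_cnj_mult_nonzero[OF a] h(2)[OF z] by simp
    then have "(norm (\<phi> ?z))\<^sup>2 * N x = (norm (h ?z - a))\<^sup>2"
      by (simp add: \<phi>_def N a_def norm_divide power_divide)
    moreover have "N x = (norm (h ?z - a))\<^sup>2 + A * (1 - (norm (h ?z))\<^sup>2)"
      unfolding N A_def by (rule moebius_identity)
    ultimately show ?thesis
      unfolding L left_diff_distrib by simp
  qed
  have dR: "(R has_real_derivative Re d) (at 1)"
    and dM: "(M has_real_derivative Im d) (at 1)"
    using has_real_derivative_along_line[of h d 0 1 1] d(1) by (simp_all add: R_def M_def)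
  have dg: "(g has_real_derivative 2 / (1 + B)) (at 1)"
    unfolding g_def using B(1)
    by (auto intro!: derivative_eq_intros simp: field_simps add_nonneg_eq_0_iff)
  have "\<exists>n'. (N has_real_derivative n') (at 1)"
    unfolding N_def by (auto intro!: exI derivative_eq_intros dR dM)
  then obtain n' where dN: "(N has_real_derivative n') (at 1)" ..
  have g1: "g 1 = 1"
    using B(1) by (simp add: g_def add.commute add_nonneg_eq_0_iff)
  have dL: "(L has_real_derivative (- A * (2 * Re d) + 2 * (2 / (1 + B)) * N 1)) (at 1)"
    unfolding L_def
    by (rule derivative_eq_intros dR dM dg dN refl)+ (simp add: g1 d(2) R_def M_def)
  have "- A * (2 * Re d) + 2 * (2 / (1 + B)) * N 1 \<le> 0"
    using derivative_nonpos_at_left_min[OF dL, of 0] L_nonneg g1 d(2) by (simp add: L)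
  moreover have "N 1 = (norm (1 - a))\<^sup>2"
    unfolding N using complex_mod_cnj[of "1 - a"] by (simp add: d(2))
  ultimately have "2 * (norm (1 - a))\<^sup>2 / (1 + B) \<le> A * Re d"
    by simp
  then have "2 * (norm (1 - a))\<^sup>2 / (1 + B) / A \<le> Re d"
    unfolding pos_divide_le_eq[OF A] by (simp only: mult.commute)
  also have "2 * (norm (1 - a))\<^sup>2 / (1 + B) / A = 2 * (norm (1 - a))\<^sup>2 / (A + norm (deriv h 0))"
  proof -
    have "(1 + B) * A = A + norm (deriv h 0)"
      using A unfolding B(2) by (simp add: distrib_right)
    then show ?thesis
      by (simp only: divide_divide_eq_left)
  qed
  finally show "Re d \<ge> 2 * (norm (1 - h 0))\<^sup>2 / (1 - (norm (h 0))\<^sup>2 + norm (deriv h 0))"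
    by (simp add: a_def A_def)
qed

text \<open>
  Equality makes the normalised function a rotation \<open>\<alpha> z\<close>, so \<open>h\<close> is a Moebius transformation
  \<open>\<alpha> (z - u) / (1 - cnj u z)\<close>; the boundary value \<open>h 1 = 1\<close> determines \<open>\<alpha>\<close>.
\<close>

lemma schwarz_pick_equality:
  assumes h: "h holomorphic_on ball 0 1" "\<And>z. norm z < 1 \<Longrightarrow> norm (h z) < 1"
    and d: "isCont h 1" "h 1 = 1"
    and eq: "norm (deriv h 0) = 1 - (norm (h 0))\<^sup>2"
  obtains u where "norm u < 1"
    "\<And>z. norm z < 1 \<Longrightarrow> h z = (z - u) / (1 - cnj u * z) * ((1 - cnj u) / (1 - u))"
proof -
  define a where "a = h 0"
  have a: "norm a < 1"
    using h(2) by (simp add: a_def)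
  define \<phi> where "\<phi> = (\<lambda>z. (h z - h 0) / (1 - cnj (h 0) * h z))"
  note \<phi> = moebius_vanishing_at_0[OF h \<phi>_def]
  have deriv_\<phi>: "deriv \<phi> 0 = deriv h 0 / of_real (1 - (norm (h 0))\<^sup>2)"
    by (rule \<phi>(4))
  from a have "1 - (norm (h 0))\<^sup>2 > 0"
    by (simp add: abs_square_less_1 a_def)
  then have "norm (deriv \<phi> 0) = 1"
    unfolding deriv_\<phi> norm_divide norm_of_real eq by simp
  then obtain \<alpha> where \<alpha>: "\<And>z. norm z < 1 \<Longrightarrow> \<phi> z = \<alpha> * z" "norm \<alpha> = 1"
    using Schwarz_Lemma(3)[OF \<phi>(1-3), of 0] by auto
  have \<alpha>1: "cnj \<alpha> * \<alpha> = 1"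
    using \<alpha>(2) complex_norm_square[of \<alpha>] by (simp add: mult.commute)
  define u where "u = - (cnj \<alpha> * a)"
  have u: "norm u < 1"
    using a \<alpha>(2) by (simp add: u_def norm_mult)
  have a_u: "a = - (\<alpha> * u)"
    using \<alpha>1 by (simp add: u_def mult.assoc[symmetric] mult.commute[of \<alpha>])
  have form: "h z * (1 - cnj u * z) = \<alpha> * (z - u)" if z: "norm z < 1" for z
  proof -
    have "1 - cnj a * h z \<noteq> 0"
      using one_minus_cnj_mult_nonzero[OF a] h(2)[OF z] by simp
    then have "h z - a = \<alpha> * z * (1 - cnj a * h z)"
      using \<alpha>(1)[OF z] by (simp add: \<phi>_def a_def field_simps)
    then have "h z + \<alpha> * u = \<alpha> * z + (cnj \<alpha> * \<alpha>) * cnj u * z * h z"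
      by (simp add: a_u algebra_simps)
    then show ?thesis
      unfolding \<alpha>1 by (simp add: algebra_simps)
  qed
  \<comment> \<open>Letting \<open>z\<close> tend to \<open>1\<close> along the radius in \<open>form\<close> determines \<open>\<alpha>\<close>.\<close>
  have lim: "((\<lambda>x. h (of_real x) * (1 - cnj u * of_real x) - \<alpha> * (of_real x - u))
      \<longlongrightarrow> h (of_real 1) * (1 - cnj u * of_real 1) - \<alpha> * (of_real 1 - u)) (at_left (1::real))"
    using d(1)
    by (intro tendsto_intros isCont_tendsto_compose[of "of_real 1" h]) (auto intro!: tendsto_intros)
  have "h (of_real 1) * (1 - cnj u * of_real 1) - \<alpha> * (of_real 1 - u) = 0"
  proof (rule tendsto_unique[OF _ lim])
    have "\<forall>\<^sub>F x in at_left (1::real).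
        0 = h (of_real x) * (1 - cnj u * of_real x) - \<alpha> * (of_real x - u)"
      using eventually_at_left_real[of 0 "1::real"] by (auto elim!: eventually_mono simp: form)
    then show "((\<lambda>x. h (of_real x) * (1 - cnj u * of_real x) - \<alpha> * (of_real x - u)) \<longlongrightarrow> 0)
        (at_left (1::real))"
      by (rule Lim_transform_eventually[OF tendsto_const])
  qed simp
  then have "1 - cnj u = \<alpha> * (1 - u)"
    using d(2) by simp
  moreover have "1 - u \<noteq> 0"
    using u by auto
  ultimately have \<alpha>u: "\<alpha> = (1 - cnj u) / (1 - u)"
    by (simp add: field_simps)
  show ?thesis
  proof (rule that[OF u])
    fix z :: complex assume z: "norm z < 1"
    have "1 - cnj u * z \<noteq> 0"
      using one_minus_cnj_mult_nonzero[OF u] z by simp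
    then have "h z = (z - u) / (1 - cnj u * z) * \<alpha>"
      using form[OF z] by (simp add: field_simps)
    then show "h z = (z - u) / (1 - cnj u * z) * ((1 - cnj u) / (1 - u))"
      unfolding \<alpha>u .
  qed
qed

section \<open>Slice regular functions in slice coordinates\<close>

lemma slice_emb_Complex: "slice_emb I (Complex x y) = slice_pt I x y"
  by (simp add: slice_emb_def)

lemma slice_dy_eq:
  assumes "slice_regular_on f \<Omega>" "I \<in> imag_units" "slice_pt I x y \<in> \<Omega>"
  shows "slice_dy f I x y = I * slice_dx f I x y"
proof -
  have "slice_dx f I x y + I * slice_dy f I x y = 0"
    using assms unfolding slice_regular_on_def by force
  then have "I * (I * slice_dy f I x y) = I * (- slice_dx f I x y)"
    by (simp add: add_eq_0_iff)
  then show ?thesis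
    by (simp add: imag_units_sq[OF assms(2)] flip: mult.assoc)
qed

lemma slice_deriv_eq_dx:
  assumes "slice_regular_on f \<Omega>" "I \<in> imag_units" "slice_pt I x y \<in> \<Omega>"
  shows "slice_deriv f (slice_pt I x y) = slice_dx f I x y"
  unfolding slice_deriv_slice_pt[OF assms] slice_dy_eq[OF assms]
  by (simp add: imag_units_sq[OF assms(2)] flip: mult.assoc scaleR_2)

text \<open>
  Continuous partial derivatives give real differentiability in \<open>(x, y)\<close>, and the projection, being
  linear over \<open>\<complex>\<^sub>I\<close> acting from the left, turns the equation \<open>\<partial>f/\<partial>y = I \<partial>f/\<partial>x\<close> into the
  Cauchy-Riemann equation. The constant factor \<open>w\<close> on the right gives access to both components of
  \<open>f\<close>: \<open>w = 1\<close> for the first and \<open>w = - J\<close> for the second.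
\<close>

lemma slice_has_field_derivative:
  assumes f: "slice_regular_on f \<Omega>" and "open \<Omega>" and I: "I \<in> imag_units"
    and z: "slice_emb I z \<in> \<Omega>"
  shows "((\<lambda>z. slice_proj I (f (slice_emb I z) * w)) has_field_derivative
    slice_proj I (slice_deriv f (slice_emb I z) * w)) (at z)"
proof -
  define V where "V = {(x, y). slice_pt I x y \<in> \<Omega>}"
  define g where "g x y = slice_proj I (f (slice_pt I x y) * w)" for x y
  define x0 y0 where "x0 = Re z" and "y0 = Im z"
  have pt0: "slice_emb I z = slice_pt I x0 y0"
    by (simp add: slice_emb_def x0_def y0_def)
  have C1: "slice_C1 f I \<Omega>"
    using f I by (simp add: slice_regular_on_def)
  have "V = (\<lambda>p. slice_pt I (fst p) (snd p)) -` \<Omega>"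
    by (auto simp: V_def)
  then have "open V"
    unfolding slice_pt_def by (auto intro!: open_vimage \<open>open \<Omega>\<close> continuous_intros)
  moreover have "(x0, y0) \<in> V"
    using z by (simp add: V_def pt0)
  ultimately obtain X Y' where XY': "open X" "open Y'" "x0 \<in> X" "y0 \<in> Y'" "X \<times> Y' \<subseteq> V"
    by (auto elim: open_prod_elim)
  then obtain e where e: "e > 0" "ball y0 e \<subseteq> Y'"
    by (auto simp: open_contains_ball)
  define Y where "Y = ball y0 e"
  have XY: "X \<times> Y \<subseteq> V" "y0 \<in> Y" "convex Y" "open Y"
    using XY' e by (auto simp: Y_def)
  have lin: "bounded_linear (\<lambda>p. slice_proj I (p * w))"
    by (intro bounded_linear_compose[OF bounded_linear_slice_proj[OF I]] bounded_linear_mult_left)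
  have dx: "((\<lambda>t. g t y) has_vector_derivative slice_proj I (slice_dx f I x y * w)) (at x)"
    and dy: "((\<lambda>t. g x t) has_vector_derivative slice_proj I (slice_dy f I x y * w)) (at y)"
    if "(x, y) \<in> V" for x y
    using C1 that unfolding g_def slice_C1_def slice_dx_def slice_dy_def V_def
    by (auto intro!: bounded_linear.has_vector_derivative[OF lin] vector_derivative_works[THEN iffD1])
  define fy where "fy x y = blinfun_scaleR_left (slice_proj I (slice_dy f I x y * w))" for x y
  have "continuous_on V (\<lambda>p. case p of (x, y) \<Rightarrow> slice_dy f I x y)"
    using C1 by (simp add: slice_C1_def V_def)
  then have "continuous_on V (\<lambda>p. slice_proj I ((case p of (x, y) \<Rightarrow> slice_dy f I x y) * w))"
    by (rule bounded_linear.continuous_on[OF lin])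
  then have "continuous_on V (\<lambda>p. blinfun_scaleR_left
      (slice_proj I ((case p of (x, y) \<Rightarrow> slice_dy f I x y) * w)))"
    by (rule bounded_linear.continuous_on[OF bounded_linear_blinfun_scaleR_left])
  then have cont: "continuous_on V (\<lambda>(x, y). fy x y)"
    by (simp add: fy_def case_prod_unfold)
  have "((\<lambda>(x, y). g x y) has_derivative
      (\<lambda>(tx, ty). tx *\<^sub>R slice_proj I (slice_dx f I x0 y0 * w) + blinfun_apply (fy x0 y0) ty))
      (at (x0, y0) within X \<times> Y)"
  proof (rule has_derivative_partialsI)
    show "((\<lambda>x. g x y0) has_derivative (\<lambda>tx. tx *\<^sub>R slice_proj I (slice_dx f I x0 y0 * w)))
        (at x0 within X)"
      using dx[of x0 y0] \<open>(x0, y0) \<in> V\<close>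
      by (auto simp: has_vector_derivative_def intro: has_derivative_at_withinI)
    show "((\<lambda>y. g x y) has_derivative blinfun_apply (fy x y)) (at y within Y)"
      if "x \<in> X" "y \<in> Y" for x y
      using dy[of x y] XY(1) that
      by (auto simp: has_vector_derivative_def fy_def blinfun_scaleR_left.rep_eq
          intro: has_derivative_at_withinI)
    show "continuous (at (x0, y0) within X \<times> Y) (\<lambda>(x, y). fy x y)"
      using continuous_on_subset[OF cont XY(1)] XY'(3) XY(2) by (simp add: continuous_on_eq_continuous_within)
  qed (use XY in auto)
  moreover have "at (x0, y0) within X \<times> Y = at (x0, y0)"
    using XY' XY by (intro at_within_open) (auto intro: open_Times)
  ultimately have "((\<lambda>p. g (fst p) (snd p)) has_derivative
      (\<lambda>p. fst p *\<^sub>R slice_proj I (slice_dx f I x0 y0 * w) + snd p *\<^sub>R slice_proj I (slice_dy f I x0 y0 * w)))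
      (at (Re z, Im z))"
    by (simp add: case_prod_unfold fy_def x0_def y0_def)
  then have "((\<lambda>z. g (Re z) (Im z)) has_derivative
      (\<lambda>v. Re v *\<^sub>R slice_proj I (slice_dx f I x0 y0 * w) + Im v *\<^sub>R slice_proj I (slice_dy f I x0 y0 * w)))
      (at z)"
    using has_derivative_compose[of "\<lambda>z. (Re z, Im z)" "\<lambda>v. (Re v, Im v)" z UNIV
        "\<lambda>p. g (fst p) (snd p)" "\<lambda>p. fst p *\<^sub>R slice_proj I (slice_dx f I x0 y0 * w)
          + snd p *\<^sub>R slice_proj I (slice_dy f I x0 y0 * w)"]
    by (simp add: has_derivative_Pair bounded_linear_imp_has_derivative bounded_linear_Re bounded_linear_Im)
  moreover have "slice_dy f I x0 y0 = I * slice_dx f I x0 y0"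
    using slice_dy_eq[OF f I] z by (simp add: pt0)
  moreover have "slice_deriv f (slice_emb I z) = slice_dx f I x0 y0"
    using slice_deriv_eq_dx[OF f I] z by (simp add: pt0)
  moreover have "Re v *\<^sub>R c + Im v *\<^sub>R (\<i> * c) = c * v" for v c :: complex
    by (simp add: complex_eq_iff algebra_simps)
  ultimately show ?thesis
    unfolding has_field_derivative_def
    by (simp add: g_def slice_emb_def mult.assoc slice_proj_unit_mult[OF I])
qed

lemma open_slice_vimage: "open \<Omega> \<Longrightarrow> open (slice_emb I -` \<Omega>)"
  by (intro open_vimage linear_continuous_on bounded_linear_slice_emb)

lemma slice_proj_holomorphic:
  assumes "slice_regular_on f \<Omega>" "open \<Omega>" "I \<in> imag_units"
  shows "(\<lambda>z. slice_proj I (f (slice_emb I z) * w)) holomorphic_on slice_emb I -` \<Omega>"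
  unfolding holomorphic_on_open[OF open_slice_vimage[OF assms(2)]]
  using slice_has_field_derivative[OF assms] by blast

text \<open>
  The converse direction: from holomorphic components, the derivative of \<open>f\<close> along any curve in the
  slice. Horizontal and vertical lines give the two partial derivatives.
\<close>

lemma slice_curve_derivative:
  assumes frame: "slice_frame I J" and "open U"
    and f: "\<And>z. z \<in> U \<Longrightarrow> f (slice_emb I z) = slice_emb I (A z) + slice_emb I (B z) * J"
    and \<gamma>: "(\<gamma> has_vector_derivative v) (at t)" "continuous_on UNIV \<gamma>" "\<gamma> t \<in> U"
    and A: "(A has_field_derivative A') (at (\<gamma> t))" and B: "(B has_field_derivative B') (at (\<gamma> t))"
  shows "((\<lambda>t. f (slice_emb I (\<gamma> t))) has_vector_derivative
    slice_emb I v * (slice_emb I A' + slice_emb I B' * J)) (at t)"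
proof -
  have I: "I \<in> imag_units"
    using frame by (simp add: slice_frame_def)
  note chain = field_vector_diff_chain_at[OF \<gamma>(1) A, unfolded o_def]
    field_vector_diff_chain_at[OF \<gamma>(1) B, unfolded o_def]
  have "((\<lambda>t. slice_emb I (A (\<gamma> t)) + slice_emb I (B (\<gamma> t)) * J) has_vector_derivative
      slice_emb I (v * A') + slice_emb I (v * B') * J) (at t)"
    by (rule has_vector_derivative_add
        bounded_linear.has_vector_derivative[OF bounded_linear_compose[OF bounded_linear_mult_left
            bounded_linear_slice_emb]]
        bounded_linear.has_vector_derivative[OF bounded_linear_slice_emb] chain)+
  then have "((\<lambda>t. f (slice_emb I (\<gamma> t))) has_vector_derivative
      slice_emb I (v * A') + slice_emb I (v * B') * J) (at t)"
    by (rule has_vector_derivative_transform_within_open[where S = "\<gamma> -` U"])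
      (use \<gamma>(3) open_vimage[OF \<open>open U\<close> \<gamma>(2)] in \<open>auto simp: f\<close>)
  then show ?thesis
    by (simp add: slice_emb_mult[OF I] distrib_left mult.assoc)
qed

section \<open>Quaternionic power series on the unit ball\<close>

definition qpower_series :: "(quat \<Rightarrow> quat) \<Rightarrow> (nat \<Rightarrow> quat) \<Rightarrow> bool" where
  "qpower_series f a \<longleftrightarrow> (\<forall>q\<in>qball. (\<lambda>n. q ^ n * a n) sums f q)"

lemma bounded_linear_qRe: "bounded_linear qRe"
proof (rule bounded_linear_intro[where K = 1])
  fix q :: quat
  have "(qRe q)\<^sup>2 \<le> (norm q)\<^sup>2"
    by (simp add: norm_quat_sq)
  then show "norm (qRe q) \<le> norm q * 1"
    using abs_le_square_iff[of "qRe q" "norm q"] by simp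
qed simp_all

lemma qRe_mult_qcnj: "qRe (p * qcnj p) = (norm p)\<^sup>2"
  unfolding norm_quat_sq quat_mult_sel qcnj_sel by (simp add: power2_eq_square)

text \<open>
  Pairing the difference of the coefficients with the conjugate of its \<open>m\<close>-th term gives a real power
  series that vanishes identically, and its \<open>m\<close>-th coefficient is \<open>\<bar>a m - b m\<bar>\<^sup>2\<close>.
\<close>

lemma power_series_unique_on_reals:
  assumes a: "\<And>x::real. \<bar>x\<bar> < 1 \<Longrightarrow> (\<lambda>n. of_real x ^ n * a n) sums g x"
    and b: "\<And>x::real. \<bar>x\<bar> < 1 \<Longrightarrow> (\<lambda>n. of_real x ^ n * b n) sums (g x :: quat)"
  shows "a = b"
proof
  fix m
  define c where "c n = qRe ((a n - b n) * qcnj (a m - b m))" for n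
  have sums: "(\<lambda>n. c n * x ^ n) sums 0" if "\<bar>x\<bar> < 1" for x :: real
  proof -
    have "(\<lambda>n. qRe ((of_real x ^ n * a n - of_real x ^ n * b n) * qcnj (a m - b m))) sums
        qRe ((g x - g x) * qcnj (a m - b m))"
      by (rule bounded_linear.sums[OF bounded_linear_qRe] sums_mult2 sums_diff a[OF that] b[OF that])+
    moreover have "(of_real x ^ n * a n - of_real x ^ n * b n) * qcnj (a m - b m) =
        x ^ n *\<^sub>R ((a n - b n) * qcnj (a m - b m))" for n
    proof -
      have "of_real x ^ n * p = x ^ n *\<^sub>R p" for p :: quat
        by (metis of_real_power scaleR_conv_of_real)
      then show ?thesis
        by (simp only: mult_scaleR_left scaleR_diff_right[symmetric])
    qed
    ultimately show ?thesis
      by (simp add: c_def mult.commute)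
  qed
  have "c m = 0"
  proof (cases "m = 0")
    case True
    then show ?thesis
      using sums[of 0] by simp
  next
    case False
    show ?thesis
    proof (rule ccontr)
      assume "c m \<noteq> 0"
      then show False
      proof (rule powser_0_nonzero[of 1 0 c "\<lambda>_. 0 :: real" m, rotated 3])
        fix s :: real assume "0 < s" "\<And>z::real. z \<in> cball 0 s - {0} \<Longrightarrow> (0::real) \<noteq> 0"
        from this(2)[of s] this(1) show False
          by simp
      qed (use sums False in auto)
    qed
  qed
  then show "a m = b m"
    by (simp add: c_def qRe_mult_qcnj)
qed

lemma qpower_series_on_reals:
  assumes "qpower_series f a" "\<bar>x\<bar> < 1" shows "(\<lambda>n. of_real x ^ n * a n) sums f (of_real x)"
  using assms by (simp add: qpower_series_def)

lemma qpower_series_unique: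
  assumes "qpower_series f a" "qpower_series g b" "\<And>x. \<bar>x\<bar> < 1 \<Longrightarrow> f (of_real x) = g (of_real x)"
  shows "a = b"
proof (rule power_series_unique_on_reals)
  fix x :: real assume x: "\<bar>x\<bar> < 1"
  show "(\<lambda>n. of_real x ^ n * a n) sums f (of_real x)" "(\<lambda>n. of_real x ^ n * b n) sums f (of_real x)"
    using qpower_series_on_reals[OF assms(1) x] qpower_series_on_reals[OF assms(2) x] assms(3)[OF x]
    by simp_all
qed

lemma qpower_series_eq_on_ball:
  assumes "qpower_series f a" "qpower_series g b" "\<And>x. \<bar>x\<bar> < 1 \<Longrightarrow> f (of_real x) = g (of_real x)"
    and "q \<in> qball"
  shows "f q = g q"
proof (rule sums_unique2)
  show "(\<lambda>n. q ^ n * a n) sums f q" "(\<lambda>n. q ^ n * a n) sums g q"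
    using assms(1,2,4) qpower_series_unique[OF assms(1-3)] by (simp_all add: qpower_series_def)
qed

lemma qcoeff_eq:
  assumes "qpower_series f a" shows "qcoeff f = a"
  unfolding qcoeff_def qpower_series_def[symmetric]
  by (rule the_equality[of "qpower_series f", OF assms]) (rule qpower_series_unique[OF _ assms refl])

lemma qpower_series_at_0:
  assumes "qpower_series f a" shows "f 0 = a 0"
proof -
  have "(\<lambda>n. 0 ^ n * a n) sums f 0"
    using assms by (simp add: qpower_series_def)
  moreover have "(\<lambda>n. 0 ^ n * a n) sums (\<Sum>n\<in>{0}. 0 ^ n * a n)"
    by (rule sums_finite) auto
  ultimately have "f 0 = (\<Sum>n\<in>{0}. 0 ^ n * a n)"
    by (rule sums_unique2)
  then show ?thesis
    by simp
qed

lemma qpower_series_slice_part: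
  assumes "qpower_series f a" "I \<in> imag_units" "norm z < 1"
  shows "(\<lambda>n. slice_proj I (a n * w) * z ^ n) sums slice_proj I (f (slice_emb I z) * w)"
proof -
  have "(\<lambda>n. slice_proj I (slice_emb I z ^ n * a n * w)) sums slice_proj I (f (slice_emb I z) * w)"
    using assms by (intro bounded_linear.sums[OF bounded_linear_slice_proj] sums_mult2)
      (simp_all add: qpower_series_def norm_slice_emb)
  then show ?thesis
    by (simp add: mult.assoc slice_proj_emb_mult[OF assms(2)] mult.commute[of _ "z ^ _"]
        flip: slice_emb_power[OF assms(2)])
qed

lemma sums_from_slice_parts:
  assumes "\<alpha> sums s" "\<beta> sums t"
    and "\<And>n. c n = slice_emb I (\<alpha> n) + slice_emb I (\<beta> n) * J"
  shows "c sums (slice_emb I s + slice_emb I t * J)"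
proof -
  have "(\<lambda>n. slice_emb I (\<alpha> n) + slice_emb I (\<beta> n) * J) sums (slice_emb I s + slice_emb I t * J)"
    by (rule sums_add sums_mult2 bounded_linear.sums[OF bounded_linear_slice_emb] assms(1,2))+
  moreover have "c = (\<lambda>n. slice_emb I (\<alpha> n) + slice_emb I (\<beta> n) * J)"
    using assms(3) by (rule ext)
  ultimately show ?thesis
    by (simp only:)
qed

lemma slice_emb_mult_power:
  assumes "I \<in> imag_units" shows "slice_emb I (c * z ^ n) = slice_emb I z ^ n * slice_emb I c"
  unfolding mult.commute[of c] slice_emb_mult[OF assms] slice_emb_power[OF assms] ..

lemma slice_decomp_mult:
  assumes "slice_frame I J"
  shows "slice_emb I z ^ n * p =
    slice_emb I (slice_proj I p * z ^ n) + slice_emb I (slice_proj I (p * (- J)) * z ^ n) * J"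
proof -
  have I: "I \<in> imag_units"
    using assms by (simp add: slice_frame_def)
  have "p = slice_emb I (slice_proj I p) + slice_emb I (slice_proj I (p * (- J))) * J"
    unfolding mult_minus_right by (rule slice_decomp[OF assms])
  from arg_cong[OF this, of "\<lambda>p. slice_emb I z ^ n * p"] show ?thesis
    unfolding slice_emb_mult_power[OF I] by (simp only: distrib_left mult.assoc)
qed

text \<open>
  On each slice both components of the sum are complex power series, so termwise differentiation is
  that of the complex theory; the common derivative \<open>D\<close> is the derivative in the real direction.
\<close>

lemma qpower_series_slice_regular:
  assumes f: "qpower_series f a"
  shows "slice_regular_on f qball"
    and "qpower_series (slice_deriv f) (\<lambda>n. real (Suc n) *\<^sub>R a (Suc n))"
proof -
  have *: "\<exists>D. continuous_on (ball 0 1) D \<and> (\<forall>x y. slice_pt I x y \<in> qball \<longrightarrow>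
       ((\<lambda>t. f (slice_pt I t y)) has_vector_derivative D (Complex x y)) (at x) \<and>
       ((\<lambda>t. f (slice_pt I x t)) has_vector_derivative I * D (Complex x y)) (at y)) \<and>
       (\<forall>z. norm z < 1 \<longrightarrow> (\<lambda>n. slice_emb I z ^ n * (real (Suc n) *\<^sub>R a (Suc n))) sums D z)"
    if I: "I \<in> imag_units" for I
  proof -
    obtain J where J: "slice_frame I J"
      using slice_frame_exists[OF I] .
    define A where "A z = slice_proj I (f (slice_emb I z))" for z
    define B where "B z = slice_proj I (f (slice_emb I z) * (- J))" for z
    have A: "(\<lambda>n. slice_proj I (a n) * z ^ n) sums A z"
      and B: "(\<lambda>n. slice_proj I (a n * (- J)) * z ^ n) sums B z" if "norm z < 1" for z
      using qpower_series_slice_part[OF f I that, of 1] qpower_series_slice_part[OF f I that, of "- J"]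
      by (simp_all add: A_def B_def)
    have hol: "A holomorphic_on ball 0 1" "B holomorphic_on ball 0 1"
      using A B by (auto intro!: power_series_holomorphic[where z = 0])
    then have dA: "(A has_field_derivative deriv A z) (at z)" and dB: "(B has_field_derivative deriv B z) (at z)"
      if "norm z < 1" for z
      using that by (auto intro!: holomorphic_derivI[of _ "ball 0 1"])
    define D where "D z = slice_emb I (deriv A z) + slice_emb I (deriv B z) * J" for z
    have "continuous_on (ball 0 1) D"
      unfolding D_def
      by (intro continuous_on_add continuous_on_mult_right continuous_on_compose2[OF linear_continuous_on[OF bounded_linear_slice_emb]]
          holomorphic_on_imp_continuous_on holomorphic_deriv hol) auto
    moreover have "f (slice_emb I z) = slice_emb I (A z) + slice_emb I (B z) * J" for z
      unfolding A_def B_def mult_minus_right by (rule slice_decomp[OF J])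
    note curve = slice_curve_derivative[where f = f and A = A and B = B and U = "ball 0 1",
      OF J open_ball this]
    have "((\<lambda>t. f (slice_pt I t y)) has_vector_derivative D (Complex x y)) (at x)"
      "((\<lambda>t. f (slice_pt I x t)) has_vector_derivative I * D (Complex x y)) (at y)"
      if "slice_pt I x y \<in> qball" for x y
    proof -
      have z: "norm (Complex x y) < 1"
        using that by (simp add: norm_slice_emb[OF I] flip: slice_emb_Complex)
      have "((\<lambda>t. Complex t y) has_vector_derivative 1) (at x)"
        "((\<lambda>t. Complex x t) has_vector_derivative \<i>) (at y)"
        by (auto intro!: derivative_eq_intros simp: Complex_eq)
      moreover have "continuous_on UNIV (\<lambda>t. Complex t y)" "continuous_on UNIV (\<lambda>t. Complex x t)"
        by (auto intro!: continuous_intros simp: Complex_eq)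
      moreover have "slice_emb I \<i> = I"
        by (simp add: slice_emb_alt)
      ultimately show "((\<lambda>t. f (slice_pt I t y)) has_vector_derivative D (Complex x y)) (at x)"
        "((\<lambda>t. f (slice_pt I x t)) has_vector_derivative I * D (Complex x y)) (at y)"
        using curve[of "\<lambda>t. Complex t y" 1 x] curve[of "\<lambda>t. Complex x t" \<i> y] dA[OF z] dB[OF z] z
        by (simp_all add: D_def slice_emb_Complex)
    qed
    moreover have "(\<lambda>n. slice_emb I z ^ n * (real (Suc n) *\<^sub>R a (Suc n))) sums D z" if z: "norm z < 1" for z
      unfolding D_def
    proof (rule sums_from_slice_parts)
      show "(\<lambda>n. diffs (\<lambda>n. slice_proj I (a n)) n * z ^ n) sums deriv A z"
        by (rule termdiffs_sums_strong[OF A dA]) (use z in auto)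
      show "(\<lambda>n. diffs (\<lambda>n. slice_proj I (a n * (- J))) n * z ^ n) sums deriv B z"
        by (rule termdiffs_sums_strong[OF B dB]) (use z in auto)
      show "slice_emb I z ^ n * (real (Suc n) *\<^sub>R a (Suc n)) =
        slice_emb I (diffs (\<lambda>n. slice_proj I (a n)) n * z ^ n) +
        slice_emb I (diffs (\<lambda>n. slice_proj I (a n * (- J))) n * z ^ n) * J" for n
        unfolding slice_decomp_mult[OF J] mult_scaleR_left slice_proj_scaleR diffs_def
        by (simp only: scaleR_conv_of_real[of _ "_ :: complex"] of_real_of_nat_eq mult.assoc)
    qed
    ultimately show ?thesis
      by blast
  qed
  show reg: "slice_regular_on f qball"
    unfolding slice_regular_on_def
  proof (intro ballI conjI allI impI)
    fix I assume I: "I \<in> imag_units"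
    from *[OF I] obtain D where D: "continuous_on (ball 0 1) D"
      "\<And>x y. slice_pt I x y \<in> qball \<Longrightarrow>
         ((\<lambda>t. f (slice_pt I t y)) has_vector_derivative D (Complex x y)) (at x)"
      "\<And>x y. slice_pt I x y \<in> qball \<Longrightarrow>
         ((\<lambda>t. f (slice_pt I x t)) has_vector_derivative I * D (Complex x y)) (at y)"
      by blast
    have dx: "slice_dx f I x y = D (Complex x y)" and dy: "slice_dy f I x y = I * D (Complex x y)"
      if "slice_pt I x y \<in> qball" for x y
      unfolding slice_dx_def slice_dy_def using D(2,3)[OF that] by (simp_all add: vector_derivative_at)
    have "continuous_on {(x, y). slice_pt I x y \<in> qball} (\<lambda>p. D (Complex (fst p) (snd p)))"
      by (rule continuous_on_compose2[OF D(1)])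
        (auto intro!: continuous_intros simp: Complex_eq norm_slice_emb[OF I] simp flip: slice_emb_Complex)
    then have cont: "continuous_on {(x, y). slice_pt I x y \<in> qball} (\<lambda>p. D (Complex (fst p) (snd p)))"
      "continuous_on {(x, y). slice_pt I x y \<in> qball} (\<lambda>p. I * D (Complex (fst p) (snd p)))"
      by (auto intro!: continuous_on_mult_left)
    show "slice_C1 f I qball"
      unfolding slice_C1_def
    proof (intro conjI allI impI)
      show "continuous_on {(x, y). slice_pt I x y \<in> qball} (\<lambda>(x, y). slice_dx f I x y)"
        by (rule continuous_on_eq[OF cont(1)]) (auto simp: dx)
      show "continuous_on {(x, y). slice_pt I x y \<in> qball} (\<lambda>(x, y). slice_dy f I x y)"
        by (rule continuous_on_eq[OF cont(2)]) (auto simp: dy)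
    qed (blast intro: differentiableI_vector D(2,3))+
    show "(1/2) *\<^sub>R (slice_dx f I x y + I * slice_dy f I x y) = 0" if "slice_pt I x y \<in> qball" for x y
      using that by (simp add: dx dy imag_units_sq[OF I] flip: mult.assoc)
  qed
  show "qpower_series (slice_deriv f) (\<lambda>n. real (Suc n) *\<^sub>R a (Suc n))"
    unfolding qpower_series_def
  proof
    fix q :: quat assume q: "q \<in> qball"
    obtain I z where I: "I \<in> imag_units" and qz: "q = slice_emb I z"
      using quat_in_some_slice .
    have z: "norm z < 1"
      using q by (simp add: qz norm_slice_emb[OF I])
    from *[OF I] obtain D where
      "\<And>x y. slice_pt I x y \<in> qball \<Longrightarrow>
         ((\<lambda>t. f (slice_pt I t y)) has_vector_derivative D (Complex x y)) (at x)"
      and sums: "(\<lambda>n. slice_emb I z ^ n * (real (Suc n) *\<^sub>R a (Suc n))) sums D z"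
      using z by blast
    then have "((\<lambda>t. f (slice_pt I t (Im z))) has_vector_derivative D z) (at (Re z))"
      using q by (metis complex_surj qz slice_emb_def)
    then have "slice_dx f I (Re z) (Im z) = D z"
      unfolding slice_dx_def by (rule vector_derivative_at)
    then have "slice_deriv f q = D z"
      using slice_deriv_eq_dx[OF reg I, of "Re z" "Im z"] q by (simp add: qz slice_emb_def)
    then show "(\<lambda>n. q ^ n * (real (Suc n) *\<^sub>R a (Suc n))) sums slice_deriv f q"
      using sums by (simp add: qz)
  qed
qed

lemma qpower_series_iterated_slice_deriv:
  assumes "qpower_series f a"
  shows "qpower_series ((slice_deriv ^^ k) f) (\<lambda>n. (fact (n + k) / fact n) *\<^sub>R a (n + k))"
proof (induction k)
  case 0
  then show ?case
    using assms by simp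
next
  case (Suc k)
  have "real (Suc n) * (fact (Suc n + k) / fact (Suc n)) = fact (n + Suc k) / fact n" for n
    unfolding fact_Suc[of n] of_nat_mult by (simp del: of_nat_Suc fact_Suc)
  then have "(\<lambda>n. real (Suc n) *\<^sub>R (fact (Suc n + k) / fact (Suc n)) *\<^sub>R a (Suc n + k)) =
      (\<lambda>n. (fact (n + Suc k) / fact n) *\<^sub>R a (n + Suc k))"
    by (simp only: scaleR_scaleR add_Suc add_Suc_right)
  then show ?case
    using qpower_series_slice_regular(2)[OF Suc] by (simp only: funpow.simps o_apply)
qed

lemma iterated_slice_deriv_at_0:
  assumes "qpower_series f a" shows "(slice_deriv ^^ k) f 0 = fact k *\<^sub>R a k"
  using qpower_series_at_0[OF qpower_series_iterated_slice_deriv[OF assms]] by simp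

text \<open>
  Taylor expansion of the two holomorphic components gives a power series on every slice. The
  coefficients do not depend on the slice because all slices share the real axis.
\<close>

lemma slice_regular_qpower_series:
  assumes f: "slice_regular_on f \<Omega>" and \<Omega>: "open \<Omega>" "qball \<subseteq> \<Omega>"
  obtains a where "qpower_series f a"
proof -
  have ex: "\<exists>a. \<forall>z. norm z < 1 \<longrightarrow> (\<lambda>n. slice_emb I z ^ n * a n) sums f (slice_emb I z)"
    if I: "I \<in> imag_units" for I
  proof -
    obtain J where J: "slice_frame I J"
      using slice_frame_exists[OF I] .
    define A where "A z = slice_proj I (f (slice_emb I z))" for z
    define B where "B z = slice_proj I (f (slice_emb I z) * (- J))" for z
    have "ball 0 1 \<subseteq> slice_emb I -` \<Omega>"
    proof
      fix z :: complex assume "z \<in> ball 0 1"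
      then have "slice_emb I z \<in> qball"
        by (simp add: norm_slice_emb[OF I])
      then show "z \<in> slice_emb I -` \<Omega>"
        using \<Omega>(2) by blast
    qed
    then have "(\<lambda>z. slice_proj I (f (slice_emb I z) * w)) holomorphic_on ball 0 1" for w
      using slice_proj_holomorphic[OF f \<Omega>(1) I, of w] by (rule holomorphic_on_subset[rotated])
    from this[of 1] this[of "- J"] have hol: "A holomorphic_on ball 0 1" "B holomorphic_on ball 0 1"
      unfolding A_def[abs_def] B_def[abs_def] by simp_all
    define \<alpha> \<beta> where "\<alpha> n = (deriv ^^ n) A 0 / fact n" and "\<beta> n = (deriv ^^ n) B 0 / fact n" for n
    have "(\<lambda>n. slice_emb I z ^ n * (slice_emb I (\<alpha> n) + slice_emb I (\<beta> n) * J)) sums f (slice_emb I z)"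
      if "norm z < 1" for z
    proof -
      have "(\<lambda>n. \<alpha> n * z ^ n) sums A z" "(\<lambda>n. \<beta> n * z ^ n) sums B z"
        using holomorphic_power_series[OF hol(1), of z] holomorphic_power_series[OF hol(2), of z] that
        by (simp_all only: \<alpha>_def \<beta>_def mem_ball_0 diff_zero)
      then have "(\<lambda>n. slice_emb I z ^ n * (slice_emb I (\<alpha> n) + slice_emb I (\<beta> n) * J)) sums
          (slice_emb I (A z) + slice_emb I (B z) * J)"
        by (rule sums_from_slice_parts)
          (simp only: slice_emb_mult_power[OF I] distrib_left mult.assoc)
      moreover have "f (slice_emb I z) = slice_emb I (A z) + slice_emb I (B z) * J"
        unfolding A_def B_def mult_minus_right by (rule slice_decomp[OF J])
      ultimately show ?thesis
        by (simp only:)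
    qed
    then show ?thesis
      by (intro exI[of _ "\<lambda>n. slice_emb I (\<alpha> n) + slice_emb I (\<beta> n) * J"] allI impI)
  qed
  have "\<exists>a. \<forall>I\<in>imag_units. \<forall>z. norm z < 1 \<longrightarrow> (\<lambda>n. slice_emb I z ^ n * a I n) sums f (slice_emb I z)"
    by (intro bchoice ballI ex)
  then obtain a where a: "\<And>I z. I \<in> imag_units \<Longrightarrow> norm z < 1 \<Longrightarrow>
      (\<lambda>n. slice_emb I z ^ n * a I n) sums f (slice_emb I z)"
    by blast
  have real: "(\<lambda>n. of_real x ^ n * a I n) sums f (of_real x)" if "I \<in> imag_units" "\<bar>x\<bar> < 1" for I x
    using a[of I "of_real x"] that by simp
  obtain I0 :: quat where I0: "I0 \<in> imag_units"
    using quat_in_some_slice[of 0] by blast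
  have "qpower_series f (a I0)"
    unfolding qpower_series_def
  proof
    fix q :: quat assume q: "q \<in> qball"
    obtain I z where I: "I \<in> imag_units" and qz: "q = slice_emb I z"
      using quat_in_some_slice .
    have "a I = a I0"
      by (rule power_series_unique_on_reals[of "a I" "\<lambda>x. f (of_real x)" "a I0"])
        (blast intro: real I I0)+
    then show "(\<lambda>n. q ^ n * a I0 n) sums f q"
      using a[OF I, of z] q by (simp add: qz norm_slice_emb[OF I])
  qed
  then show ?thesis
    by (rule that)
qed

section \<open>The regular Moebius transformations\<close>

lemma sums_affine:
  "(\<lambda>n. q ^ n * (if n = 0 then c0 else if n = 1 then c1 else 0)) sums (c0 + q * c1 :: quat)"
proof -
  have "(\<lambda>n. q ^ n * (if n = 0 then c0 else if n = 1 then c1 else 0)) sums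
      (\<Sum>n\<in>{0, 1}. q ^ n * (if n = 0 then c0 else if n = 1 then c1 else 0))"
    by (rule sums_finite) auto
  then show ?thesis
    by simp
qed

lemma qpower_series_affine:
  "qpower_series (\<lambda>q. c0 + q * c1) (\<lambda>n. if n = 0 then c0 else if n = 1 then c1 else 0)"
  unfolding qpower_series_def using sums_affine by blast

lemma qcnj_simps [simp]: "qcnj 1 = 1" "qcnj 0 = 0" "qcnj (- q) = - qcnj q" "qcnj (qcnj q) = q"
  by (simp_all add: quat_eq_iff)

lemma norm_qcnj [simp]: "norm (qcnj q) = norm q"
  by (simp add: norm_quat_def)

lemma qcnj_mult_self: "qcnj u * u = of_real ((norm u)\<^sup>2)" "u * qcnj u = of_real ((norm u)\<^sup>2)"
  unfolding norm_quat_sq of_real_def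
  by (simp_all add: quat_eq_iff scaleR_quat_sel quat_mult_sel power2_eq_square)

lemma add_qcnj_self: "u + qcnj u = of_real (2 * qRe u)"
  unfolding of_real_def by (simp add: quat_eq_iff scaleR_quat_sel)

lemma of_real_commute: "of_real r * q = q * (of_real r :: quat)"
  by (simp add: of_real_def)

lemma reg_conj_affine: "reg_conj (\<lambda>q. 1 - q * qcnj u) q = 1 - q * u"
proof -
  have coeff: "qcoeff (\<lambda>q. 1 - q * qcnj u) = (\<lambda>n. if n = 0 then 1 else if n = 1 then - qcnj u else 0)"
    using qcoeff_eq[OF qpower_series_affine[of 1 "- qcnj u"]] by simp
  have "(\<lambda>n. q ^ n * qcnj (qcoeff (\<lambda>q. 1 - q * qcnj u) n)) =
      (\<lambda>n. q ^ n * (if n = 0 then 1 else if n = 1 then - u else 0))"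
    by (simp add: coeff fun_eq_iff)
  then show ?thesis
    unfolding reg_conj_def using sums_unique[OF sums_affine[of q 1 "- u"]] by simp
qed

lemma reg_symm_affine:
  "reg_symm (\<lambda>q. 1 - q * qcnj u) q = 1 - q * (u + qcnj u) + q\<^sup>2 * (qcnj u * u)"
proof -
  let ?a = "\<lambda>n::nat. if n = 0 then 1 else if n = 1 then - qcnj u else 0"
  let ?b = "\<lambda>n::nat. if n = 0 then 1 else if n = 1 then - u else 0"
  have coeff: "qcoeff (\<lambda>q. 1 - q * qcnj u) = ?a" "qcoeff (reg_conj (\<lambda>q. 1 - q * qcnj u)) = ?b"
    using qcoeff_eq[OF qpower_series_affine[of 1 "- qcnj u"]] qcoeff_eq[OF qpower_series_affine[of 1 "- u"]]
    by (simp_all add: reg_conj_affine[abs_def])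
  define c where "c n = (\<Sum>k\<le>n. ?a k * ?b (n - k))" for n
  have c: "c 0 = 1" "c 1 = - (u + qcnj u)" "c 2 = qcnj u * u"
    by (simp_all add: c_def numeral_2_eq_2)
  have "c n = 0" if "n \<notin> {0, 1, 2}" for n
    unfolding c_def using that by (intro sum.neutral) auto
  then have "(\<lambda>n. q ^ n * c n) sums (\<Sum>n\<in>{0, 1, 2}. q ^ n * c n)"
    by (intro sums_finite) auto
  also have "(\<Sum>n\<in>{0, 1, 2}. q ^ n * c n) = c 0 + (q * c 1 + q\<^sup>2 * c 2)"
    by simp
  also have "\<dots> = 1 - q * (u + qcnj u) + q\<^sup>2 * (qcnj u * u)"
    unfolding c by (simp add: algebra_simps)
  finally show ?thesis
    unfolding reg_symm_def reg_prod_def coeff c_def[symmetric] by (rule sums_unique[symmetric])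
qed

text \<open>
  This form of \<open>1 - 2 q Re u + q\<^sup>2 \<bar>u\<bar>\<^sup>2\<close> shows that it vanishes nowhere on the ball, and it
  matches the recursion for the partial sums of \<open>\<Sum> q\<^sup>n (qcnj u)\<^sup>n\<close>.
\<close>

lemma reg_symm_affine_factor:
  "reg_symm (\<lambda>q. 1 - q * qcnj u) q = (1 - q * u) - q * (1 - q * u) * qcnj u"
  unfolding reg_symm_affine qcnj_mult_self
  by (simp add: algebra_simps power2_eq_square qcnj_mult_self)

lemma one_minus_mult_nonzero:
  fixes p q :: quat
  assumes "norm p < 1" "norm q < 1" shows "1 - p * q \<noteq> 0"
proof
  assume "1 - p * q = 0"
  then have "norm p * norm q = 1"
    by (metis eq_iff_diff_eq_0 norm_mult norm_one)
  moreover have "norm p * norm q \<le> norm p * 1"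
    using assms by (intro mult_left_mono) auto
  ultimately show False
    using assms by simp
qed

lemma reg_symm_affine_nonzero:
  assumes "norm u < 1" "norm q < 1"
  shows "reg_symm (\<lambda>q. 1 - q * qcnj u) q \<noteq> 0"
proof
  assume "reg_symm (\<lambda>q. 1 - q * qcnj u) q = 0"
  then have "1 - q * u = q * (1 - q * u) * qcnj u"
    unfolding reg_symm_affine_factor by (rule eq_iff_diff_eq_0[THEN iffD2])
  from arg_cong[OF this, of norm] have "norm (1 - q * u) = norm q * norm (1 - q * u) * norm u"
    by (simp only: norm_mult norm_qcnj)
  then have "norm (1 - q * u) * (1 - norm q * norm u) = 0"
    by (simp add: right_diff_distrib mult.commute mult.left_commute)
  moreover have "norm (1 - q * u) \<noteq> 0"
    using one_minus_mult_nonzero[OF assms(2,1)] by simp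
  moreover have "norm q * norm u \<noteq> 1"
    using assms mult_strict_mono'[of "norm q" 1 "norm u" 1] by simp
  ultimately show False
    by simp
qed

text \<open>
  The partial sums \<open>t\<close> satisfy \<open>t - q t (qcnj u) = 1 - q\<^sup>N (qcnj u)\<^sup>N\<close>. Applying the same operation with
  \<open>u\<close> in place of \<open>qcnj u\<close> turns the left-hand side into the symmetrisation times \<open>t\<close>, because \<open>u + qcnj u\<close>
  and \<open>qcnj u * u\<close> are real and hence central. Solving for \<open>t\<close> gives the sum in closed form.
\<close>

lemma qpower_series_reg_recip:
  assumes u: "norm u < 1"
  shows "qpower_series (reg_recip (\<lambda>q. 1 - q * qcnj u)) (\<lambda>n. qcnj u ^ n)"
  unfolding qpower_series_def
proof
  fix q :: quat assume "q \<in> qball"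
  then have q: "norm q < 1"
    by simp
  define S where "S = reg_symm (\<lambda>q. 1 - q * qcnj u) q"
  have S0: "S \<noteq> 0"
    unfolding S_def by (rule reg_symm_affine_nonzero[OF u q])
  define t where "t N = (\<Sum>n<N. q ^ n * qcnj u ^ n)" for N
  define E where "E N = 1 - q ^ N * qcnj u ^ N" for N
  have E: "E N = t N - q * t N * qcnj u" for N
  proof (induction N)
    case (Suc N)
    have "t (Suc N) - q * t (Suc N) * qcnj u = E N + q ^ N * qcnj u ^ N - q * (q ^ N * qcnj u ^ N) * qcnj u"
      unfolding Suc by (simp add: t_def algebra_simps)
    then show ?case
      by (simp add: E_def mult.assoc power_commutes)
  qed (simp add: E_def t_def)
  have "S * t N = E N - q * E N * u" for N
  proof -
    have "q * (u + qcnj u) * t N = q * t N * (u + qcnj u)"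
      unfolding add_qcnj_self mult.assoc of_real_commute[of _ "t N"] ..
    moreover have "q\<^sup>2 * (qcnj u * u) * t N = q * (q * t N * qcnj u) * u"
    proof -
      have "qcnj u * u * t N = t N * (qcnj u * u)"
        unfolding qcnj_mult_self by (rule of_real_commute)
      then have "q\<^sup>2 * (qcnj u * u * t N) = q\<^sup>2 * (t N * (qcnj u * u))"
        by (rule arg_cong)
      then show ?thesis
        by (simp only: power2_eq_square mult.assoc)
    qed
    ultimately have "S * t N = t N - q * t N * (u + qcnj u) + q * (q * t N * qcnj u) * u"
      unfolding S_def reg_symm_affine by (simp only: left_diff_distrib distrib_right mult_1_left)
    then show ?thesis
      unfolding E by (simp add: algebra_simps)
  qed
  moreover have "inverse S * (S * t N) = t N" for N
    using S0 by (simp flip: mult.assoc)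
  ultimately have t: "inverse S * (E N - q * E N * u) = t N" for N
    by (simp only:)
  have "norm q * norm u < 1"
    using u q mult_strict_mono'[of "norm q" 1 "norm u" 1] by simp
  then have "(\<lambda>N. (norm q * norm u) ^ N) \<longlonglongrightarrow> 0"
    by (intro LIMSEQ_realpow_zero) auto
  then have "(\<lambda>N. q ^ N * qcnj u ^ N) \<longlonglongrightarrow> 0"
    by (rule Lim_null_comparison[rotated]) (simp add: norm_mult norm_power power_mult_distrib)
  then have "E \<longlonglongrightarrow> 1 - 0"
    unfolding E_def[abs_def] by (intro tendsto_intros)
  then have "(\<lambda>N. inverse S * (E N - q * E N * u)) \<longlonglongrightarrow> inverse S * ((1 - 0) - q * (1 - 0) * u)"
    by (intro tendsto_intros)
  then show "(\<lambda>n. q ^ n * qcnj u ^ n) sums reg_recip (\<lambda>q. 1 - q * qcnj u) q"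
    unfolding sums_def reg_recip_def reg_conj_affine S_def[symmetric] t t_def by simp
qed

text \<open>
  The unimodular factor that normalises the transformation to take the value \<open>1\<close> at \<open>1\<close>.
\<close>

definition moebius_const :: "quat \<Rightarrow> quat" where
  "moebius_const u = (1 - qcnj u) * inverse (1 - u)"

lemma reg_moebius_sums:
  assumes u: "norm u < 1" and q: "norm q < 1"
  defines "s \<equiv> reg_recip (\<lambda>q. 1 - q * qcnj u) q"
  defines "m \<equiv> \<lambda>n. (if n = 0 then 0 else qcnj u ^ (n - 1) * moebius_const u) - qcnj u ^ n * u * moebius_const u"
  shows "(\<lambda>n. q ^ n * m n) sums ((q * s - s * u) * moebius_const u)"
    and "reg_moebius u q = (q * s - s * u) * moebius_const u"
proof -
  define c where "c = moebius_const u"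
  have s: "(\<lambda>n. q ^ n * qcnj u ^ n) sums s"
    using qpower_series_reg_recip[OF u] q by (simp add: qpower_series_def s_def)
  have "(\<lambda>n. q * (q ^ n * qcnj u ^ n) * c) sums (q * s * c)"
    by (intro sums_mult sums_mult2 s)
  then have "(\<lambda>n. q ^ Suc n * (if Suc n = 0 then 0 else qcnj u ^ (Suc n - 1) * c)) sums (q * s * c)"
    by (simp add: mult.assoc)
  from sums_Suc[OF this] have "(\<lambda>n. q ^ n * (if n = 0 then 0 else qcnj u ^ (n - 1) * c)) sums (q * s * c)"
    by simp
  moreover have "(\<lambda>n. q ^ n * qcnj u ^ n * (u * c)) sums (s * (u * c))"
    by (intro sums_mult2 s)
  ultimately have "(\<lambda>n. q ^ n * (if n = 0 then 0 else qcnj u ^ (n - 1) * c) - q ^ n * qcnj u ^ n * (u * c)) sums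
      (q * s * c - s * (u * c))"
    by (rule sums_diff)
  then show sums: "(\<lambda>n. q ^ n * m n) sums ((q * s - s * u) * moebius_const u)"
    unfolding m_def c_def by (simp only: right_diff_distrib left_diff_distrib mult.assoc)
  have "qpower_series (\<lambda>q. (q - u) * (1 - qcnj u) * inverse (1 - u))
      (\<lambda>n. if n = 0 then - u * c else if n = 1 then c else 0)"
    using qpower_series_affine[of "- u * c" c]
    by (simp add: c_def moebius_const_def left_diff_distrib mult.assoc)
  note coeff = qcoeff_eq[OF this] qcoeff_eq[OF qpower_series_reg_recip[OF u]]
  have "(\<Sum>k\<le>n. qcnj u ^ k * (if n - k = 0 then - u * c else if n - k = 1 then c else 0)) = m n" for n
  proof (cases n)
    case (Suc l)
    have "(\<Sum>k\<le>l. qcnj u ^ k * (if Suc l - k = 0 then - u * c else if Suc l - k = 1 then c else 0)) =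
        (\<Sum>k\<le>l. if k = l then qcnj u ^ l * c else 0)"
      by (intro sum.cong) auto
    then show ?thesis
      by (simp add: Suc m_def c_def mult.assoc)
  qed (simp add: m_def c_def)
  then show "reg_moebius u q = (q * s - s * u) * moebius_const u"
    unfolding reg_moebius_def reg_prod_def coeff using sums_unique[OF sums] by simp
qed

lemma qpower_series_reg_moebius:
  assumes "norm u < 1" obtains m where "qpower_series (reg_moebius u) m"
proof (rule that)
  show "qpower_series (reg_moebius u) (\<lambda>n. (if n = 0 then 0 else qcnj u ^ (n - 1) * moebius_const u)
      - qcnj u ^ n * u * moebius_const u)"
    unfolding qpower_series_def using reg_moebius_sums[OF assms] by simp
qed

definition disc_moebius :: "complex \<Rightarrow> complex \<Rightarrow> complex" where
  "disc_moebius u z = (z - u) / (1 - cnj u * z) * ((1 - cnj u) / (1 - u))"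

text \<open>
  At a real point all quaternions involved lie in the slice of \<open>u\<close> and commute, so the regular
  operations reduce to complex arithmetic.
\<close>

lemma reg_moebius_of_real:
  assumes I: "I \<in> imag_units" and u: "norm u < 1" and x: "\<bar>x\<bar> < 1"
  shows "reg_moebius (slice_emb I u) (of_real x) = slice_emb I (disc_moebius u (of_real x))"
proof -
  let ?u = "slice_emb I u" and ?x = "of_real x :: quat"
  have nu: "norm ?u < 1" and nx: "norm ?x < 1"
    using u x by (simp_all add: norm_slice_emb[OF I])
  have ex: "?x = slice_emb I (of_real x)"
    by simp
  have nz: "1 - of_real x * u \<noteq> 0" "1 - of_real x * cnj u \<noteq> 0"
    using one_minus_cnj_mult_nonzero[of "cnj u" "of_real x"] one_minus_cnj_mult_nonzero[of u "of_real x"] u x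
    by (simp_all add: mult.commute)
  have "inverse (a * b) * a = inverse b" if "a \<noteq> 0" for a b :: complex
    using that by simp
  note cancel = this[OF nz(1)]
  have "reg_symm (\<lambda>q. 1 - q * qcnj ?u) ?x = slice_emb I ((1 - of_real x * u) * (1 - of_real x * cnj u))"
    unfolding reg_symm_affine_factor unfolding qcnj_slice_emb[OF I] ex
    by (simp only: slice_emb_mult[OF I, symmetric] slice_emb_diff[symmetric] slice_emb_1[of I, symmetric])
      (simp add: algebra_simps)
  then have s: "reg_recip (\<lambda>q. 1 - q * qcnj ?u) ?x = slice_emb I (inverse (1 - of_real x * cnj u))"
    unfolding reg_recip_def reg_conj_affine ex
    by (simp only: slice_emb_mult[OF I, symmetric] slice_emb_diff[symmetric] slice_emb_1[of I, symmetric]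
        slice_emb_inverse[OF I, symmetric] cancel)
  have c: "moebius_const ?u = slice_emb I ((1 - cnj u) * inverse (1 - u))"
    unfolding moebius_const_def qcnj_slice_emb[OF I]
    by (simp only: slice_emb_mult[OF I] slice_emb_diff slice_emb_1 slice_emb_inverse[OF I])
  show ?thesis
    unfolding reg_moebius_sums(2)[OF nu nx] unfolding s c unfolding ex
    by (simp only: slice_emb_mult[OF I, symmetric] slice_emb_diff[symmetric])
      (simp add: disc_moebius_def divide_inverse algebra_simps)
qed

lemma qpower_series_power_mult:
  assumes "qpower_series g m"
  shows "qpower_series (\<lambda>q. q ^ n * g q) (\<lambda>k. if k < n then 0 else m (k - n))"
  unfolding qpower_series_def
proof
  fix q :: quat assume q: "q \<in> qball"
  let ?c = "\<lambda>k. q ^ k * (if k < n then 0 else m (k - n))"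
  have "(\<lambda>k. q ^ n * (q ^ k * m k)) sums (q ^ n * g q)"
    using assms q by (intro sums_mult) (simp add: qpower_series_def)
  moreover have "?c (k + n) = q ^ n * (q ^ k * m k)" for k
    by (simp add: add.commute[of k] power_add mult.assoc)
  ultimately have "(\<lambda>k. ?c (k + n)) sums (q ^ n * g q)"
    by (simp only:)
  moreover have "(\<Sum>k<n. ?c k) = 0"
    by (intro sum.neutral) auto
  ultimately show "?c sums (q ^ n * g q)"
    using sums_iff_shift[of ?c n "q ^ n * g q"] by (simp only: add_0_right)
qed

lemma norm_disc_moebius:
  assumes "norm u < 1" "norm z = 1" shows "norm (disc_moebius u z) = 1"
proof -
  have "(norm (1 - cnj u * z))\<^sup>2 = (norm (z - u))\<^sup>2"
    using moebius_identity[of u z] assms(2) by simp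
  then have "norm (1 - cnj u * z) = norm (z - u)"
    by simp
  moreover have "norm (1 - cnj u) = norm (1 - u)"
    using complex_mod_cnj[of "1 - u"] by simp
  moreover have "z \<noteq> u" "u \<noteq> 1"
    using assms by auto
  ultimately show ?thesis
    by (simp add: disc_moebius_def norm_mult norm_divide)
qed

lemma continuous_on_disc_moebius:
  assumes "norm u < 1" shows "continuous_on (cball 0 1) (disc_moebius u)"
  unfolding disc_moebius_def using one_minus_cnj_mult_nonzero[OF assms]
  by (intro continuous_intros) auto

text \<open>
  The third equation says that the lower bound for the derivative at \<open>1\<close> is attained by Moebius
  transformations.
\<close>

lemma disc_moebius_derivative:
  assumes "norm u < 1"
  shows "(disc_moebius u has_field_derivative of_real ((1 - (norm u)\<^sup>2) / (norm (1 - u))\<^sup>2)) (at 1)"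
    and "disc_moebius u 1 = 1"
    and "(norm (1 - disc_moebius u 0))\<^sup>2 / (1 - (norm (disc_moebius u 0))\<^sup>2) =
      (1 - (norm u)\<^sup>2) / (norm (1 - u))\<^sup>2"
proof -
  have u1: "1 - u \<noteq> 0" "1 - cnj u \<noteq> 0"
    using assms by auto
  have uu: "of_real ((norm u)\<^sup>2) = u * cnj u" and vv: "of_real ((norm (1 - u))\<^sup>2) = (1 - u) * (1 - cnj u)"
    using complex_norm_square[of u] complex_norm_square[of "1 - u"] by simp_all
  show "disc_moebius u 1 = 1"
    using u1 by (simp add: disc_moebius_def)
  have "(disc_moebius u has_field_derivative
      ((1 - cnj u * 1) + (1 - u) * cnj u) / ((1 - cnj u * 1) * (1 - cnj u * 1)) * ((1 - cnj u) / (1 - u))) (at 1)"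
    (is "(_ has_field_derivative ?D * ?k) _")
  proof -
    have "((\<lambda>z. (z - u) / (1 - cnj u * z)) has_field_derivative ?D) (at 1)"
      using u1(2) by (auto intro!: derivative_eq_intros)
    then show ?thesis
      unfolding disc_moebius_def by (rule DERIV_cmult_right)
  qed
  moreover have "(1 - cnj u * 1) + (1 - u) * cnj u = 1 - u * cnj u"
    by (simp add: algebra_simps)
  moreover have "a / (b * b) * (b / d) = a / (d * b)" if "b \<noteq> 0" for a b d :: complex
    using that by simp
  note this[OF u1(2)]
  ultimately have "(disc_moebius u has_field_derivative (1 - u * cnj u) / ((1 - u) * (1 - cnj u))) (at 1)"
    by (simp only: mult_1_right)
  then show "(disc_moebius u has_field_derivative of_real ((1 - (norm u)\<^sup>2) / (norm (1 - u))\<^sup>2)) (at 1)"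
    by (simp only: of_real_divide of_real_diff of_real_1 uu vv)
  have c: "norm (1 - cnj u) = norm (1 - u)"
    using complex_mod_cnj[of "1 - u"] by simp
  have norm0: "norm (disc_moebius u 0) = norm u"
    using u1 c by (simp add: disc_moebius_def norm_mult norm_divide)
  have "1 - disc_moebius u 0 = of_real (1 - (norm u)\<^sup>2) / (1 - u)"
    unfolding of_real_diff uu using u1 by (simp add: disc_moebius_def field_simps)
  then have "norm (1 - disc_moebius u 0) = \<bar>1 - (norm u)\<^sup>2\<bar> / norm (1 - u)"
    by (simp only: norm_divide norm_of_real)
  then have "(norm (1 - disc_moebius u 0))\<^sup>2 = (1 - (norm u)\<^sup>2)\<^sup>2 / (norm (1 - u))\<^sup>2"
    by (simp add: power_divide)
  moreover have "1 - (norm u)\<^sup>2 \<noteq> 0"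
    using assms abs_square_less_1[of "norm u"] by simp
  ultimately show "(norm (1 - disc_moebius u 0))\<^sup>2 / (1 - (norm (disc_moebius u 0))\<^sup>2) =
      (1 - (norm u)\<^sup>2) / (norm (1 - u))\<^sup>2"
    unfolding norm0 by (simp add: power2_eq_square)
qed

section \<open>The boundary Schwarz lemma\<close>

text \<open>
  The imaginary part of the slice projection for \<open>I\<close> is the inner product with \<open>I\<close>; the three basic
  units suffice.
\<close>

lemma quat_real_if_slice_projs_real:
  assumes "\<And>I. I \<in> imag_units \<Longrightarrow> Im (slice_proj I p) = 0" shows "p \<in> \<real>"
proof -
  have "qI p = 0" "qJ p = 0" "qK p = 0"
    using assms[of "Quat 0 1 0 0"] assms[of "Quat 0 0 1 0"] assms[of "Quat 0 0 0 1"]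
    by (simp_all add: imag_units_iff slice_proj_def quat_mult_sel)
  then have "p = of_real (qRe p)"
    by (simp add: of_real_def quat_eq_iff scaleR_quat_sel)
  then show ?thesis
    by (metis Reals_of_real)
qed

text \<open>
  The rigidity behind the equality case: when the component of \<open>f\<close> in \<open>\<complex>\<^sub>I\<close> is unimodular on the
  circle, the orthogonal component has no room left.
\<close>

lemma slice_extremal:
  assumes I: "I \<in> imag_units" and f: "slice_regular_on f \<Omega>" "open \<Omega>" "qball \<subseteq> \<Omega>"
    and bound: "f ` qball \<subseteq> qball"
    and \<Phi>: "continuous_on (cball 0 1) \<Phi>" "\<And>z. norm z = 1 \<Longrightarrow> norm (\<Phi> z) = 1"
    and eq: "\<And>z. norm z < 1 \<Longrightarrow> slice_proj I (f (slice_emb I z)) = \<Phi> z"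
    and z: "norm z < 1"
  shows "f (slice_emb I z) = slice_emb I (\<Phi> z)"
proof -
  obtain J where J: "slice_frame I J"
    using slice_frame_exists[OF I] .
  define G where "G z = slice_proj I (- (f (slice_emb I z) * J))" for z
  have in_ball: "slice_emb I w \<in> qball" if "norm w < 1" for w
    using that by (simp add: norm_slice_emb[OF I])
  have "ball 0 1 \<subseteq> slice_emb I -` \<Omega>"
  proof
    fix w :: complex assume "w \<in> ball 0 1"
    then have "slice_emb I w \<in> qball"
      by (intro in_ball) simp
    then show "w \<in> slice_emb I -` \<Omega>"
      using f(3) by blast
  qed
  then have "(\<lambda>z. slice_proj I (f (slice_emb I z) * (- J))) holomorphic_on ball 0 1"
    by (rule holomorphic_on_subset[OF slice_proj_holomorphic[OF f(1,2) I, of "- J"]])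
  then have "G holomorphic_on ball 0 1"
    unfolding G_def[abs_def] by simp
  then have "G z = 0"
  proof (rule complementary_component_vanishes[OF _ \<Phi> _ z])
    fix w :: complex assume w: "norm w < 1"
    have "(norm (\<Phi> w))\<^sup>2 + (norm (G w))\<^sup>2 = (norm (f (slice_emb I w)))\<^sup>2"
      unfolding G_def eq[OF w, symmetric] by (rule norm_slice_parts[OF J, symmetric])
    also have "\<dots> \<le> 1"
      using bound in_ball[OF w] by (intro power_le_one) (auto simp: image_subset_iff dest: less_imp_le)
    finally show "(norm (\<Phi> w))\<^sup>2 + (norm (G w))\<^sup>2 \<le> 1" .
  qed
  then show ?thesis
    using slice_decomp[OF J, of "f (slice_emb I z)"] unfolding G_def eq[OF z] by simp
qed

text \<open>
  The bounds are stated through the coefficients \<open>a\<close>; the case \<open>n = 0\<close> is the first part of the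
  theorem. A slice containing \<open>a n\<close> makes \<open>h 0\<close> equal to \<open>a n\<close> without loss, while \<open>a (Suc n)\<close> need
  not lie in that slice and enters only through \<open>\<bar>h'(0)\<bar> \<le> \<bar>a (Suc n)\<bar>\<close>.
\<close>

lemma regular_boundary_schwarz:
  fixes f :: "quat \<Rightarrow> quat"
  assumes f: "slice_regular_on f \<Omega>" "open \<Omega>" "qball \<union> {1} \<subseteq> \<Omega>"
    and bound: "f ` qball \<subseteq> qball" and f1: "f 1 = 1"
    and a: "qpower_series f a" and van: "\<And>k. k < n \<Longrightarrow> a k = 0"
  shows "slice_deriv f 1 \<in> \<real>"
    and "1 - (norm (a n))\<^sup>2 + norm (a (Suc n)) \<noteq> 0 \<Longrightarrow> qRe (slice_deriv f 1) \<ge>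
      real n + 2 * (norm (1 - a n))\<^sup>2 / (1 - (norm (a n))\<^sup>2 + norm (a (Suc n)))"
    and "1 - (norm (a n))\<^sup>2 \<noteq> 0 \<Longrightarrow>
      qRe (slice_deriv f 1) \<ge> real n + (norm (1 - a n))\<^sup>2 / (1 - (norm (a n))\<^sup>2)"
    and "1 - (norm (a n))\<^sup>2 \<noteq> 0 \<Longrightarrow>
      qRe (slice_deriv f 1) = real n + (norm (1 - a n))\<^sup>2 / (1 - (norm (a n))\<^sup>2) \<longleftrightarrow>
      (\<exists>u\<in>qball. \<forall>q\<in>qball. f q = q ^ n * reg_moebius u q)"
proof -
  define \<delta> where "\<delta> = slice_deriv f 1"
  define F where "F I z = slice_proj I (f (slice_emb I z))" for I z
  have F_deriv: "(F I has_field_derivative slice_proj I \<delta>) (at 1)"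
    and F_1: "F I 1 = 1"
    and F_less: "\<And>z. norm z < 1 \<Longrightarrow> norm (F I z) < 1"
    and F_sums: "\<And>z. norm z < 1 \<Longrightarrow> (\<lambda>k. slice_proj I (a k) * z ^ k) sums F I z"
    if I: "I \<in> imag_units" for I
  proof -
    show "(F I has_field_derivative slice_proj I \<delta>) (at 1)"
      using slice_has_field_derivative[OF f(1,2) I, of 1 1] f(3) by (simp add: F_def[abs_def] \<delta>_def)
    show "F I 1 = 1"
      by (simp add: F_def f1 slice_proj_1[OF I])
    fix z :: complex assume z: "norm z < 1"
    then have "norm (f (slice_emb I z)) < 1"
      using bound by (auto simp: image_subset_iff norm_slice_emb[OF I])
    then show "norm (F I z) < 1"
      unfolding F_def by (rule le_less_trans[OF norm_slice_proj_le[OF I]])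
    show "(\<lambda>k. slice_proj I (a k) * z ^ k) sums F I z"
      using qpower_series_slice_part[OF a I z, of 1] by (simp add: F_def)
  qed
  show real: "slice_deriv f 1 \<in> \<real>"
    unfolding \<delta>_def[symmetric]
  proof (rule quat_real_if_slice_projs_real)
    fix I assume I: "I \<in> imag_units"
    show "Im (slice_proj I \<delta>) = 0"
      using F_less[OF I] by (intro boundary_derivative_real[OF F_deriv[OF I] F_1[OF I]]) (simp add: less_imp_le)
  qed

  obtain I c where I: "I \<in> imag_units" and an: "a n = slice_emb I c"
    using quat_in_some_slice[of "a n"] .
  have norm_a: "norm (a n) = norm c"
    by (simp add: an norm_slice_emb[OF I])
  have norm_1a: "norm (1 - a n) = norm (1 - c)"
    using norm_slice_emb[OF I, of "1 - c"] by (simp add: an slice_emb_diff)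
  \<comment> \<open>The value at \<open>0\<close> removes the singularity; away from \<open>0\<close> the quotient keeps the differentiability of \<open>F\<close> at \<open>1\<close>.\<close>
  define h where "h z = (if z = 0 then c else F I z / z ^ n)" for z
  have h_sums: "(\<lambda>k. slice_proj I (a (k + n)) * z ^ k) sums h z" if z: "norm z < 1" for z
  proof (cases "z = 0")
    case True
    then show ?thesis
      using I by (simp add: h_def an powser_sums_zero_iff)
  next
    case False
    have "(\<Sum>k<n. slice_proj I (a k) * z ^ k) = 0"
      using van by (intro sum.neutral) auto
    then have "(\<lambda>k. slice_proj I (a (k + n)) * z ^ (k + n)) sums F I z"
      using F_sums[OF I z] sums_iff_shift[of "\<lambda>k. slice_proj I (a k) * z ^ k" n "F I z"] by simp
    then have "(\<lambda>k. slice_proj I (a (k + n)) * z ^ (k + n) / z ^ n) sums (F I z / z ^ n)"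
      by (rule sums_divide)
    then show ?thesis
      using False by (simp add: h_def power_add)
  qed
  have F_h: "F I z = z ^ n * h z" if "norm z < 1" for z
  proof (cases "z = 0")
    case True
    have "F I 0 = slice_proj I (a 0)"
      using F_sums[OF I, of 0] by (simp add: powser_sums_zero_iff)
    then show ?thesis
      using True I an van[of 0] by (cases "n = 0") (auto simp: h_def)
  qed (simp add: h_def)
  have h_hol: "h holomorphic_on ball 0 1"
    using h_sums by (intro power_series_holomorphic[where z = 0]) auto
  have h_le: "norm (h z) \<le> 1" if "norm z < 1" for z
    using F_less[OF I] F_h that by (intro bounded_divide_power[OF h_hol, of n]) (simp_all add: less_imp_le)
  have h0: "h 0 = c"
    by (simp add: h_def)
  have dh0: "deriv h 0 = slice_proj I (a (Suc n))"
  proof -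
    have "(\<lambda>k. diffs (\<lambda>k. slice_proj I (a (k + n))) k * 0 ^ k) sums deriv h 0"
      using h_sums holomorphic_derivI[OF h_hol, of 0] by (intro termdiffs_sums_strong[of 1 _ h]) auto
    then show ?thesis
      by (simp add: powser_sums_zero_iff diffs_def)
  qed
  have dh0_le: "norm (deriv h 0) \<le> norm (a (Suc n))"
    unfolding dh0 by (rule norm_slice_proj_le[OF I])
  have h1: "h 1 = 1"
    by (simp add: h_def F_1[OF I])
  have dh1: "(h has_field_derivative slice_proj I \<delta> - of_nat n) (at 1)"
  proof -
    have "((\<lambda>z. F I z / z ^ n) has_field_derivative slice_proj I \<delta> - of_nat n) (at 1)"
      by (rule derivative_eq_intros F_deriv[OF I] refl)+ (simp_all add: F_1[OF I])
    then show ?thesis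
      by (rule has_field_derivative_transform_within_open[where S = "- {0}"]) (auto simp: h_def)
  qed
  have Re_d: "Re (slice_proj I \<delta> - of_nat n) = qRe (slice_deriv f 1) - real n"
    by (simp add: slice_proj_def \<delta>_def)
  have h_less: "norm (h z) < 1" if "norm c \<noteq> 1" "norm z < 1" for z
  proof (rule ccontr)
    assume "\<not> norm (h z) < 1"
    then have "norm (h z) = 1"
      using h_le[OF that(2)] by simp
    moreover from this have "h 0 = h z"
      by (intro holomorphic_const_if_norm_max[OF h_hol h_le that(2)]) auto
    ultimately show False
      using that(1) h0 by simp
  qed
  have c_le: "norm c \<le> 1"
    using h_le[of 0] h0 by simp
  have extremal: "f (slice_emb I z) = slice_emb I (\<Phi> z)"
    if "continuous_on (cball 0 1) \<Phi>" "\<And>z. norm z = 1 \<Longrightarrow> norm (\<Phi> z) = 1"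
      "\<And>z. norm z < 1 \<Longrightarrow> F I z = \<Phi> z" "norm z < 1" for \<Phi> z
    using that f(3) unfolding F_def by (intro slice_extremal[OF I f(1,2) _ bound]) auto
  have extremal_const: "a (Suc n) = 0" if c1: "norm c = 1"
  proof -
    have hc: "h z = c" if "norm z < 1" for z
      using holomorphic_const_if_norm_max[OF h_hol h_le, of 0 z] that c1 h0 by simp
    have "f (of_real x) = of_real x ^ n * a n" if "\<bar>x\<bar> < 1" for x
    proof -
      have "f (slice_emb I (of_real x)) = slice_emb I (of_real x ^ n * c)"
        using that c1 by (intro extremal[of "\<lambda>z. z ^ n * c"])
          (auto intro!: continuous_intros simp: F_h hc norm_mult norm_power)
      then show ?thesis
        by (simp add: an slice_emb_mult[OF I] slice_emb_power[OF I])
    qed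
    moreover have "(\<lambda>k. of_real x ^ k * (if k = n then a n else 0)) sums (of_real x ^ n * a n)" for x :: real
    proof -
      have "(\<lambda>k. of_real x ^ k * (if k = n then a n else 0)) sums
          (\<Sum>k\<in>{n}. of_real x ^ k * (if k = n then a n else 0))"
        by (rule sums_finite) auto
      then show ?thesis
        by simp
    qed
    ultimately have "a = (\<lambda>k. if k = n then a n else 0)"
      using qpower_series_on_reals[OF a]
      by (intro power_series_unique_on_reals[of a "\<lambda>x. f (of_real x)"]) auto
    from fun_cong[OF this, of "Suc n"] show ?thesis
      by simp
  qed

  have strong: "2 * (norm (1 - c))\<^sup>2 / (1 - (norm c)\<^sup>2 + norm (deriv h 0)) \<le> qRe (slice_deriv f 1) - real n"
    and pick: "norm (deriv h 0) \<le> 1 - (norm c)\<^sup>2" and c_pos: "0 < 1 - (norm c)\<^sup>2"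
    if "norm c \<noteq> 1"
  proof -
    show "2 * (norm (1 - c))\<^sup>2 / (1 - (norm c)\<^sup>2 + norm (deriv h 0)) \<le> qRe (slice_deriv f 1) - real n"
      "norm (deriv h 0) \<le> 1 - (norm c)\<^sup>2"
      using boundary_schwarz[OF h_hol h_less[OF that] dh1 h1] unfolding h0 Re_d by simp_all
    show "0 < 1 - (norm c)\<^sup>2"
      using that c_le abs_square_less_1[of "norm c"] by simp
  qed

  show "qRe (slice_deriv f 1) \<ge>
      real n + 2 * (norm (1 - a n))\<^sup>2 / (1 - (norm (a n))\<^sup>2 + norm (a (Suc n)))"
    if "1 - (norm (a n))\<^sup>2 + norm (a (Suc n)) \<noteq> 0"
  proof -
    have c1: "norm c \<noteq> 1"
      using that extremal_const norm_a by auto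
    have "2 * (norm (1 - c))\<^sup>2 / (1 - (norm c)\<^sup>2 + norm (a (Suc n))) \<le>
        2 * (norm (1 - c))\<^sup>2 / (1 - (norm c)\<^sup>2 + norm (deriv h 0))"
      using dh0_le c_pos[OF c1] by (intro divide_left_mono) (auto intro!: mult_pos_pos add_pos_nonneg)
    then show ?thesis
      unfolding norm_a norm_1a using strong[OF c1] by linarith
  qed

  show weak: "qRe (slice_deriv f 1) \<ge> real n + (norm (1 - a n))\<^sup>2 / (1 - (norm (a n))\<^sup>2)"
    if "1 - (norm (a n))\<^sup>2 \<noteq> 0"
  proof -
    have c1: "norm c \<noteq> 1"
      using that norm_a by auto
    have "(norm (1 - c))\<^sup>2 / (1 - (norm c)\<^sup>2) = 2 * (norm (1 - c))\<^sup>2 / (2 * (1 - (norm c)\<^sup>2))"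
      by (rule mult_divide_mult_cancel_left[symmetric]) simp
    also have "\<dots> \<le> 2 * (norm (1 - c))\<^sup>2 / (1 - (norm c)\<^sup>2 + norm (deriv h 0))"
      using pick[OF c1] c_pos[OF c1] by (intro divide_left_mono) (auto intro!: mult_pos_pos add_pos_nonneg)
    also have "\<dots> \<le> qRe (slice_deriv f 1) - real n"
      by (rule strong[OF c1])
    finally show ?thesis
      unfolding norm_a norm_1a by (simp only: le_diff_eq add.commute)
  qed

  show "qRe (slice_deriv f 1) = real n + (norm (1 - a n))\<^sup>2 / (1 - (norm (a n))\<^sup>2) \<longleftrightarrow>
      (\<exists>u\<in>qball. \<forall>q\<in>qball. f q = q ^ n * reg_moebius u q)"
    if "1 - (norm (a n))\<^sup>2 \<noteq> 0"
  proof
    have c1: "norm c \<noteq> 1"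
      using that norm_a by auto
    assume eq: "qRe (slice_deriv f 1) = real n + (norm (1 - a n))\<^sup>2 / (1 - (norm (a n))\<^sup>2)"
    \<comment> \<open>Equality in the second bound and the first bound together squeeze \<open>\<bar>h'(0)\<bar>\<close> from below.\<close>
    define N D where "N = (norm (1 - c))\<^sup>2" and "D = 1 - (norm c)\<^sup>2"
    have "c \<noteq> 1"
      using c1 by auto
    then have N: "N > 0"
      by (simp add: N_def)
    have D: "D > 0"
      using c_pos[OF c1] by (simp add: D_def)
    have "2 * N / (D + norm (deriv h 0)) \<le> N / D"
      using strong[OF c1] eq unfolding norm_a norm_1a N_def D_def by simp
    moreover have "D + norm (deriv h 0) > 0"
      using D by (simp add: add_pos_nonneg)
    ultimately have "2 * N * D \<le> N * (D + norm (deriv h 0))"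
      using D by (simp add: divide_simps)
    then have "N * D \<le> N * norm (deriv h 0)"
      by (simp add: algebra_simps)
    then have "D \<le> norm (deriv h 0)"
      using N by simp
    then have "norm (deriv h 0) = 1 - (norm (h 0))\<^sup>2"
      using pick[OF c1] by (simp add: D_def h0)
    then obtain u where u: "norm u < 1" "\<And>z. norm z < 1 \<Longrightarrow> h z = disc_moebius u z"
      using schwarz_pick_equality[OF h_hol h_less[OF c1] DERIV_isCont[OF dh1] h1]
      unfolding disc_moebius_def by metis
    let ?u = "slice_emb I u"
    have nu: "norm ?u < 1"
      using u(1) by (simp add: norm_slice_emb[OF I])
    obtain m where m: "qpower_series (reg_moebius ?u) m"
      using qpower_series_reg_moebius[OF nu] .
    have "f q = q ^ n * reg_moebius ?u q" if q: "q \<in> qball" for q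
    proof (rule qpower_series_eq_on_ball[OF a qpower_series_power_mult[OF m, of n] _ q])
      fix x :: real assume x: "\<bar>x\<bar> < 1"
      have "f (slice_emb I (of_real x)) = slice_emb I (of_real x ^ n * disc_moebius u (of_real x))"
        using x u by (intro extremal[of "\<lambda>z. z ^ n * disc_moebius u z"])
          (auto intro!: continuous_intros continuous_on_disc_moebius
            simp: F_h norm_mult norm_power norm_disc_moebius)
      then show "f (of_real x) = of_real x ^ n * reg_moebius ?u (of_real x)"
        by (simp add: slice_emb_mult[OF I] slice_emb_power[OF I] reg_moebius_of_real[OF I u(1) x])
    qed
    then show "\<exists>u\<in>qball. \<forall>q\<in>qball. f q = q ^ n * reg_moebius u q"
      using nu by (intro bexI[of _ ?u]) auto
  next
    assume "\<exists>u\<in>qball. \<forall>q\<in>qball. f q = q ^ n * reg_moebius u q"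
    then obtain v where v: "v \<in> qball" "\<And>q. q \<in> qball \<Longrightarrow> f q = q ^ n * reg_moebius v q"
      by blast
    obtain K u where K: "K \<in> imag_units" and vu: "v = slice_emb K u"
      using quat_in_some_slice[of v] .
    have u: "norm u < 1"
      using v(1) by (simp add: vu norm_slice_emb[OF K])
    obtain m where m: "qpower_series (reg_moebius v) m"
      using qpower_series_reg_moebius[of v] v(1) by auto
    have f_real: "f (of_real x) = slice_emb K (of_real x ^ n * disc_moebius u (of_real x))" if x: "\<bar>x\<bar> < 1" for x
      using v(2)[of "of_real x"] x
      by (simp add: vu reg_moebius_of_real[OF K u x] slice_emb_mult[OF K] slice_emb_power[OF K])
    have "a = (\<lambda>k. if k < n then 0 else m (k - n))"
      using v(2) by (intro qpower_series_unique[OF a qpower_series_power_mult[OF m]]) auto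
    then have "a n = m 0"
      by simp
    also have "\<dots> = slice_emb K (disc_moebius u 0)"
      using qpower_series_at_0[OF m] reg_moebius_of_real[OF K u, of 0] by (simp add: vu)
    finally have an': "a n = slice_emb K (disc_moebius u 0)" .
    have norms: "norm (a n) = norm (disc_moebius u 0)" "norm (1 - a n) = norm (1 - disc_moebius u 0)"
      using norm_slice_emb[OF K, of "disc_moebius u 0"] norm_slice_emb[OF K, of "1 - disc_moebius u 0"]
      by (simp_all add: an' slice_emb_diff)
    define r where "r = (1 - (norm u)\<^sup>2) / (norm (1 - u))\<^sup>2"
    note dm = disc_moebius_derivative[OF u, folded r_def]
    \<comment> \<open>Near \<open>1\<close> the function \<open>F K\<close> is known only at real points up to \<open>1\<close>, so one-sided derivatives are compared.\<close>
    define M where "M z = z ^ n * disc_moebius u z" for z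
    have M1: "M 1 = 1"
      by (simp add: M_def dm(2))
    have "(M has_field_derivative of_nat n + of_real r) (at 1)"
      unfolding M_def by (rule derivative_eq_intros dm(1) refl)+ (simp add: dm(2))
    then have "((\<lambda>x. Re (M (of_real x))) has_real_derivative
        Re (of_nat n + of_real r)) (at 1)"
      using has_real_derivative_along_line(1)[of M "of_nat n + of_real r" 0 1 1] by simp
    then have "((\<lambda>x. Re (M (of_real x))) has_real_derivative
        real n + r) (at 1 within {0..1})"
      by (simp add: has_field_derivative_at_within)
    then have "((\<lambda>x. Re (F K (of_real x))) has_real_derivative
        real n + r) (at 1 within {0..1})"
    proof (rule has_field_derivative_transform_within[where d = 1])
      show "Re (M (of_real x)) = Re (F K (of_real x))" if "x \<in> {0..1}" for x
        using that f_real[of x] K F_1[OF K] M1 by (cases "x = 1") (auto simp: F_def M_def)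
    qed auto
    moreover have "((\<lambda>x. Re (F K (of_real x))) has_real_derivative qRe \<delta>) (at 1 within {0..1})"
      using has_real_derivative_along_line(1)[of "F K" "slice_proj K \<delta>" 0 1 1] F_deriv[OF K]
      by (simp add: slice_proj_def has_field_derivative_at_within)
    ultimately have "qRe \<delta> = real n + r"
      using vector_derivative_unique_within[of 1 "{0..1}"]
      by (auto simp: has_real_derivative_iff_has_vector_derivative trivial_limit_within)
    then show "qRe (slice_deriv f 1) = real n + (norm (1 - a n))\<^sup>2 / (1 - (norm (a n))\<^sup>2)"
      unfolding norms dm(3) \<delta>_def .
  qed
qed

theorem theorem6:
  fixes f :: "quat \<Rightarrow> quat"
  assumes "slice_regular_near f (qball \<union> {1})"
    and "f ` qball \<subseteq> qball"
    and "f 1 = 1"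
  shows
    "slice_deriv f 1 \<in> \<real>
     \<and> qRe (slice_deriv f 1)
         \<ge> 2 * (norm (1 - f 0))\<^sup>2 / (1 - (norm (f 0))\<^sup>2 + norm (slice_deriv f 0))
     \<and> qRe (slice_deriv f 1) \<ge> (norm (1 - f 0))\<^sup>2 / (1 - (norm (f 0))\<^sup>2)
     \<and> (qRe (slice_deriv f 1) = (norm (1 - f 0))\<^sup>2 / (1 - (norm (f 0))\<^sup>2) \<longleftrightarrow>
          (\<exists>u\<in>qball. \<forall>q\<in>qball. f q = reg_moebius u q))
     \<and> (\<forall>n. (\<forall>k<n. (slice_deriv ^^ k) f 0 = 0) \<longrightarrow>
          (let a = (slice_deriv ^^ n) f 0 /\<^sub>R fact n;
               b = norm ((slice_deriv ^^ Suc n) f 0) / fact (Suc n)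
           in (1 - (norm a)\<^sup>2 + b \<noteq> 0 \<longrightarrow>
                 qRe (slice_deriv f 1) \<ge> real n + 2 * (norm (1 - a))\<^sup>2 / (1 - (norm a)\<^sup>2 + b))
            \<and> (1 - (norm a)\<^sup>2 \<noteq> 0 \<longrightarrow>
                 qRe (slice_deriv f 1) \<ge> real n + (norm (1 - a))\<^sup>2 / (1 - (norm a)\<^sup>2)
                 \<and> (qRe (slice_deriv f 1) = real n + (norm (1 - a))\<^sup>2 / (1 - (norm a)\<^sup>2) \<longleftrightarrow>
                      (\<exists>u\<in>qball. \<forall>q\<in>qball. f q = q ^ n * reg_moebius u q)))))"
proof -
  obtain \<Omega> where \<Omega>: "qball \<union> {1} \<subseteq> \<Omega>" "slice_regular_on f \<Omega>" "open \<Omega>"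
    using assms(1) by (auto simp: slice_regular_near_def slice_domain_def domain_in_def)
  obtain a where a: "qpower_series f a"
    using slice_regular_qpower_series[OF \<Omega>(2,3)] \<Omega>(1) by auto
  note schwarz = regular_boundary_schwarz[OF \<Omega>(2,3,1) assms(2,3) a]
  have a0: "a 0 = f 0" and a1: "a (Suc 0) = slice_deriv f 0"
    using qpower_series_at_0[OF a] iterated_slice_deriv_at_0[OF a, of 1] by simp_all
  have "norm (f 0) < 1"
    using assms(2) by (auto simp: image_subset_iff)
  then have "1 - (norm (f 0))\<^sup>2 > 0"
    by (simp add: abs_square_less_1)
  then have nz: "1 - (norm (f 0))\<^sup>2 \<noteq> 0" "1 - (norm (f 0))\<^sup>2 + norm (slice_deriv f 0) \<noteq> 0"
    using norm_ge_zero[of "slice_deriv f 0"] by linarith+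
  have "slice_deriv f 1 \<in> \<real>
     \<and> qRe (slice_deriv f 1)
         \<ge> 2 * (norm (1 - f 0))\<^sup>2 / (1 - (norm (f 0))\<^sup>2 + norm (slice_deriv f 0))
     \<and> qRe (slice_deriv f 1) \<ge> (norm (1 - f 0))\<^sup>2 / (1 - (norm (f 0))\<^sup>2)
     \<and> (qRe (slice_deriv f 1) = (norm (1 - f 0))\<^sup>2 / (1 - (norm (f 0))\<^sup>2) \<longleftrightarrow>
          (\<exists>u\<in>qball. \<forall>q\<in>qball. f q = reg_moebius u q))"
    using schwarz[of 0] nz unfolding a0 a1 by simp
  moreover have "let b = (slice_deriv ^^ n) f 0 /\<^sub>R fact n;
               b' = norm ((slice_deriv ^^ Suc n) f 0) / fact (Suc n)
           in (1 - (norm b)\<^sup>2 + b' \<noteq> 0 \<longrightarrow>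
                 qRe (slice_deriv f 1) \<ge> real n + 2 * (norm (1 - b))\<^sup>2 / (1 - (norm b)\<^sup>2 + b'))
            \<and> (1 - (norm b)\<^sup>2 \<noteq> 0 \<longrightarrow>
                 qRe (slice_deriv f 1) \<ge> real n + (norm (1 - b))\<^sup>2 / (1 - (norm b)\<^sup>2)
                 \<and> (qRe (slice_deriv f 1) = real n + (norm (1 - b))\<^sup>2 / (1 - (norm b)\<^sup>2) \<longleftrightarrow>
                      (\<exists>u\<in>qball. \<forall>q\<in>qball. f q = q ^ n * reg_moebius u q)))"
    if "\<forall>k<n. (slice_deriv ^^ k) f 0 = 0" for n
  proof -
    have "a k = 0" if "k < n" for k
      using \<open>\<forall>k<n. (slice_deriv ^^ k) f 0 = 0\<close> that by (simp add: iterated_slice_deriv_at_0[OF a])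
    note schwarz = schwarz[OF this]
    have "(slice_deriv ^^ n) f 0 /\<^sub>R fact n = a n"
      "norm ((slice_deriv ^^ Suc n) f 0) / fact (Suc n) = norm (a (Suc n))"
      unfolding iterated_slice_deriv_at_0[OF a] by (simp_all del: fact_Suc)
    then show ?thesis
      unfolding Let_def using schwarz by (simp only:) blast
  qed
  ultimately show ?thesis
    by blast
qed

end
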